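(* Let $X=(X_1,\ldots,X_N)$ be a sequence of random variables taking values in a Polish space $\Lambda=\Lambda_1\times\cdots\times\Lambda_N$. Let $\hat X=(\hat X_1,\ldots,\hat X_n)$ be a partition of $X$, taking values in $\hat\Lambda=\hat\Lambda_1\times\cdots\times\hat\Lambda_n$, and suppose that we have a Marton coupling for $\hat X$ with mixing matrix $\Gamma$. Let $c\in\mathbb{R}_+^N$, and define $C(c)\in\mathbb{R}_+^n$ by $$C_i(c):=\sum_{j\in\mathcal{I}(\hat X_i)}c_j\quad\text{for } i\le n.$$ If $f:\Lambda\to\mathbb{R}$ is a measurable function such that $$f(x)-f(y)\le\sum_{i=1}^{N}c_i\,\mathbf{1}[x_i\ne y_i]\quad\text{for every }x,y\in\Lambda,$$ then for any $\lambda\in\mathbb{R}$, $$\log\mathbb{E}\left(e^{\lambda(f(X)-\mathbb{E}f(X))}\right)\le\frac{\lambda^2\,\|\Gamma\cdot C(c)\|^2}{8}\le\frac{\lambda^2\,\|\Gamma\|^2\|c\|^2 s(\hat X)}{8}.$$ In particular, for any $t\ge0$, $$\mathbb{P}\left(|f(X)-\mathbb{E}f(X)|\ge t\right)\le2\exp\left(\frac{-2t^2}{\|\Gamma\cdot C(c)\|^2}\right).$$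
   Context: Norms: $\|\cdot\|$ is the Euclidean norm of vectors and the corresponding operator norm of square matrices. $\mathcal{L}(\cdot\mid\cdot)$ denotes (a fixed version of the regular) conditional distribution. Partition: $\hat X=(\hat X_1,\ldots,\hat X_n)$ is a partition of $X=(X_1,\ldots,X_N)$ if the $\hat X_i$ are disjoint non-empty subsets of $\{X_1,\ldots,X_N\}$ that together cover it. $\mathcal{I}(\hat X_i)\subset\{1,\ldots,N\}$ is the set of indices $j$ with $X_j\in\hat X_i$; $s(\hat X_i)=|\mathcal{I}(\hat X_i)|$; $s(\hat X):=\max_{1\le i\le n}s(\hat X_i)$ is the size of the partition. $\hat X_i$ is regarded as a random variable with values in $\hat\Lambda_i:=\prod_{j\in\mathcal{I}(\hat X_i)}\Lambda_j$. Marton coupling: let $Y=(Y_1,\ldots,Y_m)$ be a vector of random variables with values in $E_1\times\cdots\times E_m$. A Marton coupling for $Y$ is a set of couplings $\left(Y^{(x_1,\ldots,x_i,x_i')},{Y'}^{(x_1,\ldots,x_i,x_i')}\right)$ (pairs of random vectors in $E_1\times\cdots\times E_m$ defined on a common probability space), one for every $i\in\{1,\ldots,m\}$ and every $x_1\in E_1,\ldots,x_i\in E_i$, $x_i'\in E_i$, such that, writing the superscript as $(\ast)$: (i) $Y^{(\ast)}_1=x_1,\ldots,Y^{(\ast)}_i=x_i$ and ${Y'}^{(\ast)}_1=x_1,\ldots,{Y'}^{(\ast)}_{i-1}=x_{i-1},{Y'}^{(\ast)}_i=x_i'$; (ii) $(Y^{(\ast)}_{i+1},\ldots,Y^{(\ast)}_m)\sim\mathcal{L}(Y_{i+1},\ldots,Y_m\mid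 Y_1=x_1,\ldots,Y_i=x_i)$ and $({Y'}^{(\ast)}_{i+1},\ldots,{Y'}^{(\ast)}_m)\sim\mathcal{L}(Y_{i+1},\ldots,Y_m\mid Y_1=x_1,\ldots,Y_{i-1}=x_{i-1},Y_i=x_i')$; (iii) if $x_i=x_i'$ then $Y^{(\ast)}={Y'}^{(\ast)}$. Its mixing matrix $\Gamma=(\Gamma_{i,j})_{i,j\le m}$ is given by $\Gamma_{i,i}:=1$, and for $1\le i<j\le m$, $\Gamma_{j,i}:=0$ and $\Gamma_{i,j}:=\sup_{x_1,\ldots,x_i,x_i'}\mathbb{P}\left[Y^{(x_1,\ldots,x_i,x_i')}_j\ne{Y'}^{(x_1,\ldots,x_i,x_i')}_j\right]$. *)

theory Defs
  imports "HOL-Probability.Probability"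
begin

text \<open>Spaces that may differ from coordinate to coordinate are topologies (or measure spaces) on one
  carrier type, and finite families are functions on \<open>{1..m}\<close>, extensional when they are points of a
  product space.\<close>

definition separable_topology :: "'a topology \<Rightarrow> bool" where
  "separable_topology T \<longleftrightarrow>
     (\<exists>D. countable D \<and> D \<subseteq> topspace T \<and> T closure_of D = topspace T)"

definition polish_topology :: "'a topology \<Rightarrow> bool" where
  "polish_topology T \<longleftrightarrow> completely_metrizable_space T \<and> separable_topology T"

definition borel_of :: "'a topology \<Rightarrow> 'a measure" where
  "borel_of T = sigma (topspace T) {U. openin T U}"

text \<open>A finite product of Polish spaces carries the product \<open>\<sigma>\<close>-algebra \<open>PiM\<close>; by separability this is
  the Borel \<open>\<sigma>\<close>-algebra of the product topology.\<close>

abbreviation borel_prod :: "nat set \<Rightarrow> (nat \<Rightarrow> 'a topology) \<Rightarrow> (nat \<Rightarrow> 'a) measure" where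
  "borel_prod J \<Lambda> \<equiv> PiM J (\<lambda>j. borel_of (\<Lambda> j))"


text \<open>\<open>K\<close> is a version of the regular conditional distribution of \<open>V\<close> given \<open>U\<close>: a probability kernel
  from \<open>A\<close> to \<open>B\<close> such that \<open>K (U \<omega>) S\<close> is a version of the conditional probability of \<open>V \<in> S\<close> given
  the \<open>\<sigma>\<close>-algebra generated by \<open>U\<close>, for every measurable \<open>S\<close>.\<close>

definition is_regular_cond_distr ::
  "'w measure \<Rightarrow> 'a measure \<Rightarrow> 'b measure \<Rightarrow> ('w \<Rightarrow> 'a) \<Rightarrow> ('w \<Rightarrow> 'b) \<Rightarrow> ('a \<Rightarrow> 'b measure) \<Rightarrow> bool" where
  "is_regular_cond_distr M A B U V K \<longleftrightarrow>
     K \<in> A \<rightarrow>\<^sub>M prob_algebra B \<and>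
     (\<forall>S\<in>sets B. AE \<omega> in M. measure (K (U \<omega>)) S =
        real_cond_exp M (vimage_algebra (space M) U A) (\<lambda>\<omega>. indicator S (V \<omega>)) \<omega>)"

text \<open>\<open>L i x\<close> is the fixed version of the law of \<open>(Y\<^sub>i\<^sub>+\<^sub>1, \<dots>, Y\<^sub>m)\<close> given
  \<open>Y\<^sub>1 = x 1, \<dots>, Y\<^sub>i = x i\<close>.\<close>

definition cond_distr_versions ::
  "'w measure \<Rightarrow> nat \<Rightarrow> (nat \<Rightarrow> 'e measure) \<Rightarrow> ('w \<Rightarrow> nat \<Rightarrow> 'e)
     \<Rightarrow> (nat \<Rightarrow> (nat \<Rightarrow> 'e) \<Rightarrow> (nat \<Rightarrow> 'e) measure) \<Rightarrow> bool" where
  "cond_distr_versions M m E Y L \<longleftrightarrow>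
     (\<forall>i\<in>{1..m}. is_regular_cond_distr M (PiM {1..i} E) (PiM {i+1..m} E)
        (\<lambda>\<omega>. restrict (Y \<omega>) {1..i}) (\<lambda>\<omega>. restrict (Y \<omega>) {i+1..m}) (L i))"


text \<open>The coupling with superscript \<open>(x\<^sub>1, \<dots>, x\<^sub>i, x\<^sub>i')\<close> lives on the probability space
  \<open>P i x x'\<close> and consists of the random vectors \<open>V i x x'\<close> and \<open>V' i x x'\<close>, where
  \<open>x = (x\<^sub>1, \<dots>, x\<^sub>i)\<close> and \<open>x' = x\<^sub>i'\<close>. Equalities between random variables are almost sure.\<close>

definition marton_coupling ::
  "nat \<Rightarrow> (nat \<Rightarrow> 'e measure) \<Rightarrow> (nat \<Rightarrow> (nat \<Rightarrow> 'e) \<Rightarrow> (nat \<Rightarrow> 'e) measure)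
     \<Rightarrow> (nat \<Rightarrow> (nat \<Rightarrow> 'e) \<Rightarrow> 'e \<Rightarrow> 'c measure)
     \<Rightarrow> (nat \<Rightarrow> (nat \<Rightarrow> 'e) \<Rightarrow> 'e \<Rightarrow> 'c \<Rightarrow> nat \<Rightarrow> 'e)
     \<Rightarrow> (nat \<Rightarrow> (nat \<Rightarrow> 'e) \<Rightarrow> 'e \<Rightarrow> 'c \<Rightarrow> nat \<Rightarrow> 'e) \<Rightarrow> bool" where
  "marton_coupling m E L P V V' \<longleftrightarrow>
     (\<forall>i\<in>{1..m}. \<forall>x \<in> (\<Pi>\<^sub>E k\<in>{1..i}. space (E k)). \<forall>x' \<in> space (E i).
        prob_space (P i x x') \<and>
        V i x x' \<in> P i x x' \<rightarrow>\<^sub>M PiM {1..m} E \<and>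
        V' i x x' \<in> P i x x' \<rightarrow>\<^sub>M PiM {1..m} E \<and>
        (AE \<omega> in P i x x'. (\<forall>k\<in>{1..i}. V i x x' \<omega> k = x k) \<and>
           (\<forall>k\<in>{1..<i}. V' i x x' \<omega> k = x k) \<and> V' i x x' \<omega> i = x') \<and>
        distr (P i x x') (PiM {i+1..m} E) (\<lambda>\<omega>. restrict (V i x x' \<omega>) {i+1..m}) = L i x \<and>
        distr (P i x x') (PiM {i+1..m} E) (\<lambda>\<omega>. restrict (V' i x x' \<omega>) {i+1..m}) = L i (x(i := x')) \<and>
        (x i = x' \<longrightarrow> (AE \<omega> in P i x x'. V i x x' \<omega> = V' i x x' \<omega>)))"

definition mixing_matrix ::
  "(nat \<Rightarrow> 'e measure)
     \<Rightarrow> (nat \<Rightarrow> (nat \<Rightarrow> 'e) \<Rightarrow> 'e \<Rightarrow> 'c measure)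
     \<Rightarrow> (nat \<Rightarrow> (nat \<Rightarrow> 'e) \<Rightarrow> 'e \<Rightarrow> 'c \<Rightarrow> nat \<Rightarrow> 'e)
     \<Rightarrow> (nat \<Rightarrow> (nat \<Rightarrow> 'e) \<Rightarrow> 'e \<Rightarrow> 'c \<Rightarrow> nat \<Rightarrow> 'e) \<Rightarrow> nat \<Rightarrow> nat \<Rightarrow> real" where
  "mixing_matrix E P V V' i j =
     (if i = j then 1
      else if i < j then
        (SUP (x, x') \<in> (\<Pi>\<^sub>E k\<in>{1..i}. space (E k)) \<times> space (E i).
           measure (P i x x') {\<omega> \<in> space (P i x x'). V i x x' \<omega> j \<noteq> V' i x x' \<omega> j})
      else 0)"


text \<open>A partition of \<open>(X\<^sub>1, \<dots>, X\<^sub>N)\<close> is given by its index sets \<open>I i\<close>, \<open>i \<in> {1..n}\<close>.\<close>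

definition index_partition :: "nat \<Rightarrow> nat \<Rightarrow> (nat \<Rightarrow> nat set) \<Rightarrow> bool" where
  "index_partition N n I \<longleftrightarrow>
     disjoint_family_on I {1..n} \<and> (\<forall>i\<in>{1..n}. I i \<noteq> {}) \<and> (\<Union>i\<in>{1..n}. I i) = {1..N}"

definition partition_size :: "nat \<Rightarrow> (nat \<Rightarrow> nat set) \<Rightarrow> nat" where
  "partition_size n I = Max ((\<lambda>i. card (I i)) ` {1..n})"

definition rvec :: "nat set \<Rightarrow> (nat \<Rightarrow> 'w \<Rightarrow> 'a) \<Rightarrow> 'w \<Rightarrow> nat \<Rightarrow> 'a" where
  "rvec J X \<omega> = (\<lambda>j\<in>J. X j \<omega>)"

definition partitioned :: "nat \<Rightarrow> (nat \<Rightarrow> nat set) \<Rightarrow> (nat \<Rightarrow> 'w \<Rightarrow> 'a) \<Rightarrow> 'w \<Rightarrow> nat \<Rightarrow> nat \<Rightarrow> 'a" where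
  "partitioned n I X \<omega> = (\<lambda>i\<in>{1..n}. rvec (I i) X \<omega>)"

definition block_sum :: "(nat \<Rightarrow> nat set) \<Rightarrow> (nat \<Rightarrow> real) \<Rightarrow> nat \<Rightarrow> real" where
  "block_sum I c i = (\<Sum>j\<in>I i. c j)"


text \<open>Vectors in \<open>\<real>\<^sup>n\<close> and real square matrices are functions of indices in \<open>{1..n}\<close>; the Euclidean norm
  of a vector \<open>v\<close> is \<open>L2_set v {1..n}\<close>.\<close>

definition mat_vec :: "nat \<Rightarrow> (nat \<Rightarrow> nat \<Rightarrow> real) \<Rightarrow> (nat \<Rightarrow> real) \<Rightarrow> nat \<Rightarrow> real" where
  "mat_vec n A v i = (\<Sum>j\<in>{1..n}. A i j * v j)"

definition operator_norm :: "nat \<Rightarrow> (nat \<Rightarrow> nat \<Rightarrow> real) \<Rightarrow> real" where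
  "operator_norm n A = (SUP v \<in> {v. L2_set v {1..n} \<le> 1}. L2_set (mat_vec n A v) {1..n})"

end

theory Submission
  imports Defs "HOL-Probability.Hoeffding"
begin

text \<open>Let \<open>Y\<close> be the vector of blocks and \<open>F\<close> the function with \<open>F Y = f X\<close>. The martingale
  \<open>E (F Y | Y\<^sub>1, \<dots>, Y\<^sub>i)\<close> is \<open>g\<^sub>i (Y\<^sub>1, \<dots>, Y\<^sub>i)\<close>, where \<open>g\<^sub>i x\<close> integrates \<open>F\<close> against the fixed version
  of the conditional law given \<open>x\<close>. The Marton coupling bounds the oscillation of \<open>g\<^sub>i\<close> in its last
  argument by \<open>(\<Gamma> C)\<^sub>i\<close>, for every value of the other arguments. Hoeffding's lemma, applied under each
  measure of the kernel separately, then gives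
  \<open>E exp (l g\<^sub>i) \<le> exp (l\<^sup>2 (\<Gamma> C)\<^sub>i\<^sup>2 / 8) E exp (l g\<^sub>i\<^sub>-\<^sub>1)\<close>, and these inequalities are multiplied. Working
  fibrewise avoids measurability questions for the infimum of \<open>g\<^sub>i\<close> over its last argument.\<close>

section \<open>Disintegration\<close>

text \<open>Integral form of a regular conditional law: the law of \<open>(U, V)\<close> is the law
  of \<open>U\<close> followed by \<open>K\<close>. Testing against joint functions \<open>h\<close>
  lets a factor that depends on \<open>U\<close> be carried along, and no null sets depending on a
  set \<open>S\<close> remain.\<close>

definition disintegrates ::
  "'w measure \<Rightarrow> 'a measure \<Rightarrow> 'b measure \<Rightarrow> ('w \<Rightarrow> 'a) \<Rightarrow> ('w \<Rightarrow> 'b) \<Rightarrow> ('a \<Rightarrow> 'b measure) \<Rightarrow> bool" where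
  "disintegrates M A B U V K \<longleftrightarrow>
     U \<in> M \<rightarrow>\<^sub>M A \<and> V \<in> M \<rightarrow>\<^sub>M B \<and> K \<in> A \<rightarrow>\<^sub>M prob_algebra B \<and>
     (\<forall>h\<in>borel_measurable (A \<Otimes>\<^sub>M B).
        (\<integral>\<^sup>+\<omega>. h (U \<omega>, V \<omega>) \<partial>M) = (\<integral>\<^sup>+\<omega>. \<integral>\<^sup>+y. h (U \<omega>, y) \<partial>K (U \<omega>) \<partial>M))"

text \<open>The parameter enters both the integrand and the measure. Pushing \<open>K x\<close>
  forward along \<open>Pair x\<close> moves it into the measure alone, and then \<open>h\<close> is
  a fixed function integrated against a measurable kernel on the product.\<close>

lemma kernel_integral_measurable:
  fixes h :: "'a \<times> 'b \<Rightarrow> real"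
  assumes K: "K \<in> A \<rightarrow>\<^sub>M prob_algebra B" and h[measurable]: "h \<in> borel_measurable (A \<Otimes>\<^sub>M B)"
  shows "(\<lambda>x. \<integral>y. h (x, y) \<partial>K x) \<in> borel_measurable A"
proof -
  note [measurable] = measurable_prob_algebraD[OF K]
  have [measurable]: "(\<lambda>x. distr (K x) (A \<Otimes>\<^sub>M B) (Pair x)) \<in> A \<rightarrow>\<^sub>M subprob_algebra (A \<Otimes>\<^sub>M B)"
    by (rule measurable_distr2[where M=B]) measurable
  have "(\<lambda>x. \<integral>z. h z \<partial>distr (K x) (A \<Otimes>\<^sub>M B) (Pair x)) \<in> borel_measurable A"
    by measurable
  then show ?thesis
  proof (rule measurable_cong[THEN iffD1, rotated])
    fix x assume x: "x \<in> space A"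
    have "Pair x \<in> K x \<rightarrow>\<^sub>M A \<Otimes>\<^sub>M B"
      using x measurable_space[OF K x] by (simp add: space_prob_algebra cong: measurable_cong_sets)
    then show "(\<integral>z. h z \<partial>distr (K x) (A \<Otimes>\<^sub>M B) (Pair x)) = (\<integral>y. h (x, y) \<partial>K x)"
      by (subst integral_distr) auto
  qed
qed

text \<open>Conditioning on a constant leaves the law of \<open>V\<close> unchanged. This is the
  case of the empty prefix, where the martingale starts.\<close>

lemma disintegrates_const:
  assumes "prob_space M" "V \<in> M \<rightarrow>\<^sub>M B" "a \<in> space A"
  shows "disintegrates M A B (\<lambda>_. a) V (\<lambda>_. distr M B V)"
proof -
  interpret prob_space M by fact
  note [measurable] = assms(2)
  have "(\<integral>\<^sup>+\<omega>. h (a, V \<omega>) \<partial>M) = (\<integral>\<^sup>+\<omega>. \<integral>\<^sup>+y. h (a, y) \<partial>distr M B V \<partial>M)"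
    if [measurable]: "h \<in> borel_measurable (A \<Otimes>\<^sub>M B)" for h :: "_ \<Rightarrow> ennreal"
    using assms(3) by (simp add: nn_integral_distr emeasure_space_1)
  moreover have "distr M B V \<in> space (prob_algebra B)"
    by (simp add: space_prob_algebra prob_space_distr)
  ultimately show ?thesis
    using assms by (auto simp: disintegrates_def)
qed

text \<open>The defining property of conditional expectation, tested with
  \<open>indicator a (U \<omega>)\<close>, which is measurable for the \<sigma>-algebra generated by
  \<open>U\<close>.\<close>

lemma real_cond_exp_vimage_integral:
  assumes "prob_space M" "U \<in> M \<rightarrow>\<^sub>M A" "a \<in> sets A" "integrable M f"
  shows "(\<integral>\<omega>. indicator a (U \<omega>) * real_cond_exp M (vimage_algebra (space M) U A) f \<omega> \<partial>M)
       = (\<integral>\<omega>. indicator a (U \<omega>) * f \<omega> \<partial>M)"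
proof -
  interpret prob_space M by fact
  let ?F = "vimage_algebra (space M) U A"
  note [measurable] = assms(2,3)
  interpret finite_measure_subalgebra M ?F
    by unfold_locales (simp add: subalgebra_def sets_image_in_sets[OF refl assms(2)])
  have [measurable]: "U \<in> ?F \<rightarrow>\<^sub>M A"
    using assms(2) by (intro measurable_vimage_algebra1) (auto intro: measurable_space[OF assms(2)])
  have f[measurable]: "f \<in> borel_measurable M"
    using assms(4) by simp
  have "integrable M (\<lambda>\<omega>. indicator a (U \<omega>) * f \<omega>)"
    by (rule Bochner_Integration.integrable_bound[OF assms(4)]) (auto simp: indicator_def)
  then show ?thesis
    by (intro real_cond_exp_intg(2)) auto
qed

text \<open>The definition of a conditional law speaks of one set \<open>S\<close> at a time, with
  an exceptional set that may depend on \<open>S\<close>. Integrating over a rectangle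
  \<open>a \<times> b\<close> uses a single \<open>S = b\<close>, so the two candidate joint laws
  agree on rectangles; these are stable under intersection and generate the product
  \<sigma>-algebra, so the laws coincide.\<close>

lemma regular_cond_distr_disintegrates:
  assumes "prob_space M" "U \<in> M \<rightarrow>\<^sub>M A" "V \<in> M \<rightarrow>\<^sub>M B" "is_regular_cond_distr M A B U V K"
  shows "disintegrates M A B U V K"
proof -
  interpret prob_space M by fact
  note [measurable] = assms(2,3)
  have K: "K \<in> A \<rightarrow>\<^sub>M prob_algebra B" 
    and K_eq: "\<And>S. S \<in> sets B \<Longrightarrow> AE \<omega> in M. measure (K (U \<omega>)) S =
        real_cond_exp M (vimage_algebra (space M) U A) (\<lambda>\<omega>. indicator S (V \<omega>)) \<omega>"
    using assms(4) by (auto simp: is_regular_cond_distr_def)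
  note Ks[measurable] = measurable_prob_algebraD[OF K]
  \<comment> \<open>\<open>J x\<close> is the law of \<open>(x, y)\<close> with \<open>y\<close>
    drawn from \<open>K x\<close>; binding \<open>M\<close> with \<open>J (U \<omega>)\<close>
    yields the joint law that \<open>K\<close> prescribes.\<close>
  define J where "J x = distr (K x) (A \<Otimes>\<^sub>M B) (Pair x)" for x
  have J[measurable]: "J \<in> A \<rightarrow>\<^sub>M subprob_algebra (A \<Otimes>\<^sub>M B)"
    unfolding J_def by (rule measurable_distr2[where M=B]) measurable
  have KU: "prob_space (K (U \<omega>))" "sets (K (U \<omega>)) = sets B" if "\<omega> \<in> space M" for \<omega>
    using measurable_space[OF K measurable_space[OF assms(2) that]]
    by (auto simp: space_prob_algebra)
  let ?g = "{a \<times> b |a b. a \<in> sets A \<and> b \<in> sets B}"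
  let ?D = "distr M (A \<Otimes>\<^sub>M B) (\<lambda>\<omega>. (U \<omega>, V \<omega>))"
  let ?D' = "M \<bind> (\<lambda>\<omega>. J (U \<omega>))"
  have J': "(\<lambda>\<omega>. J (U \<omega>)) \<in> M \<rightarrow>\<^sub>M subprob_algebra (A \<Otimes>\<^sub>M B)"
    by measurable
  have sets': "sets ?D' = sets (A \<Otimes>\<^sub>M B)"
    using sets_kernel[OF J'] not_empty by (intro sets_bind)
  have eq: "?D = ?D'"
  proof (rule measure_eqI_generator_eq[OF Int_stable_pair_measure_generator[of A B]])
    show "?g \<subseteq> Pow (space A \<times> space B)"
      using sets.space_closed[of A] sets.space_closed[of B] by auto
    show "sets ?D = sigma_sets (space A \<times> space B) ?g" "sets ?D' = sigma_sets (space A \<times> space B) ?g"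
      using sets' by (auto simp: sets_pair_measure)
    show "range (\<lambda>i::nat. space A \<times> space B) \<subseteq> ?g" by auto
    show "(\<Union>i::nat. space A \<times> space B) = space A \<times> space B" by simp
    show "emeasure ?D (space A \<times> space B) \<noteq> \<infinity>"
      by (subst emeasure_distr) (auto simp: space_pair_measure[symmetric])
    fix X assume "X \<in> ?g"
    then obtain a b where X: "X = a \<times> b" and [measurable]: "a \<in> sets A" "b \<in> sets B" by auto
    have mb[measurable]: "(\<lambda>\<omega>. measure (K (U \<omega>)) b) \<in> borel_measurable M"
      by measurable
    have "emeasure ?D' X = (\<integral>\<^sup>+\<omega>. emeasure (J (U \<omega>)) X \<partial>M)"
      using not_empty by (intro emeasure_bind[OF _ J']) (auto simp: X)
    also have "\<dots> = (\<integral>\<^sup>+\<omega>. ennreal (indicator a (U \<omega>) * measure (K (U \<omega>)) b) \<partial>M)"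
    proof (rule nn_integral_cong)
      fix \<omega> assume w: "\<omega> \<in> space M"
      interpret k: prob_space "K (U \<omega>)" using KU[OF w] by simp
      have U: "U \<omega> \<in> space A" by (rule measurable_space[OF assms(2) w])
      have "Pair (U \<omega>) -` (a \<times> b) \<inter> space (K (U \<omega>)) = (if U \<omega> \<in> a then b else {})"
        using sets.sets_into_space[of b B] sets_eq_imp_space_eq[OF KU(2)[OF w]] by auto
      moreover have "Pair (U \<omega>) \<in> K (U \<omega>) \<rightarrow>\<^sub>M A \<Otimes>\<^sub>M B"
        using KU(2)[OF w] U by (simp cong: measurable_cong_sets)
      ultimately show "emeasure (J (U \<omega>)) X = ennreal (indicator a (U \<omega>) * measure (K (U \<omega>)) b)"
        unfolding J_def by (subst emeasure_distr) (auto simp: X k.emeasure_eq_measure)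
    qed
    also have "\<dots> = ennreal (\<integral>\<omega>. indicator a (U \<omega>) * measure (K (U \<omega>)) b \<partial>M)"
    proof (rule nn_integral_eq_integral)
      show "integrable M (\<lambda>\<omega>. indicator a (U \<omega>) * measure (K (U \<omega>)) b)"
        by (rule integrable_const_bound[where B=1])
           (auto intro!: AE_I2 mult_le_one prob_space.prob_le_1 KU(1) simp: indicator_def)
    qed auto
    also have "(\<integral>\<omega>. indicator a (U \<omega>) * measure (K (U \<omega>)) b \<partial>M) =
      (\<integral>\<omega>. indicator a (U \<omega>) * real_cond_exp M (vimage_algebra (space M) U A) (\<lambda>\<omega>. indicator b (V \<omega>)) \<omega> \<partial>M)"
    proof (rule integral_cong_AE)
      show "(\<lambda>\<omega>. indicator a (U \<omega>) * real_cond_exp M (vimage_algebra (space M) U A) (\<lambda>\<omega>. indicator b (V \<omega>)) \<omega>) \<in> borel_measurable M"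
        by (intro borel_measurable_times borel_measurable_cond_exp2) measurable
      show "AE \<omega> in M. indicator a (U \<omega>) * measure (K (U \<omega>)) b = indicator a (U \<omega>) *
         real_cond_exp M (vimage_algebra (space M) U A) (\<lambda>\<omega>. indicator b (V \<omega>)) \<omega>"
        by (rule eventually_mono[OF K_eq[OF \<open>b \<in> sets B\<close>]]) auto
    qed measurable
    also have "\<dots> = (\<integral>\<omega>. indicator a (U \<omega>) * indicator b (V \<omega>) \<partial>M)"
      by (rule real_cond_exp_vimage_integral)
         (auto simp: assms intro!: integrable_const_bound[where B=1] simp: indicator_def)
    also have "ennreal \<dots> = (\<integral>\<^sup>+\<omega>. ennreal (indicator a (U \<omega>) * indicator b (V \<omega>)) \<partial>M)"
      by (rule nn_integral_eq_integral[symmetric])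
         (auto intro!: integrable_const_bound[where B=1] simp: indicator_def)
    also have "\<dots> = (\<integral>\<^sup>+\<omega>. indicator X (U \<omega>, V \<omega>) \<partial>M)"
      by (intro nn_integral_cong) (auto simp: X indicator_def)
    also have "\<dots> = (\<integral>\<^sup>+z. indicator X z \<partial>?D)"
      by (subst nn_integral_distr) (auto simp: X)
    also have "\<dots> = emeasure ?D X"
      by (subst nn_integral_indicator) (auto simp: X)
    finally show "emeasure ?D X = emeasure ?D' X" by simp
  qed
  have "(\<integral>\<^sup>+\<omega>. h (U \<omega>, V \<omega>) \<partial>M) = (\<integral>\<^sup>+\<omega>. \<integral>\<^sup>+y. h (U \<omega>, y) \<partial>K (U \<omega>) \<partial>M)"
    if [measurable]: "h \<in> borel_measurable (A \<Otimes>\<^sub>M B)" for h :: "_ \<Rightarrow> ennreal"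
  proof -
    have "(\<integral>\<^sup>+\<omega>. h (U \<omega>, V \<omega>) \<partial>M) = (\<integral>\<^sup>+z. h z \<partial>?D)"
      by (subst nn_integral_distr) auto
    also have "\<dots> = (\<integral>\<^sup>+\<omega>. \<integral>\<^sup>+z. h z \<partial>J (U \<omega>) \<partial>M)"
      unfolding eq by (rule nn_integral_bind[OF that J'])
    also have "\<dots> = (\<integral>\<^sup>+\<omega>. \<integral>\<^sup>+y. h (U \<omega>, y) \<partial>K (U \<omega>) \<partial>M)"
    proof (rule nn_integral_cong)
      fix \<omega> assume w: "\<omega> \<in> space M"
      have U: "U \<omega> \<in> space A" by (rule measurable_space[OF assms(2) w])
      have "Pair (U \<omega>) \<in> K (U \<omega>) \<rightarrow>\<^sub>M A \<Otimes>\<^sub>M B"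
        using KU(2)[OF w] U by (simp cong: measurable_cong_sets)
      then show "(\<integral>\<^sup>+z. h z \<partial>J (U \<omega>)) = (\<integral>\<^sup>+y. h (U \<omega>, y) \<partial>K (U \<omega>))"
        unfolding J_def by (subst nn_integral_distr) auto
    qed
    finally show ?thesis .
  qed
  then show ?thesis using K assms by (auto simp: disintegrates_def)
qed

text \<open>Adding \<open>b\<close> makes the integrand nonnegative, so the identity for
  \<open>h + b\<close> comes from the nonnegative integral. Boundedness makes all integrals finite
  on probability spaces, so \<open>b\<close> can be subtracted again.\<close>

lemma disintegrates_integral:
  fixes h :: "'a \<times> 'b \<Rightarrow> real"
  assumes "prob_space M" "disintegrates M A B U V K"
    and h[measurable]: "h \<in> borel_measurable (A \<Otimes>\<^sub>M B)"
    and b: "\<And>z. z \<in> space (A \<Otimes>\<^sub>M B) \<Longrightarrow> \<bar>h z\<bar> \<le> b"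
  shows "(\<integral>\<omega>. h (U \<omega>, V \<omega>) \<partial>M) = (\<integral>\<omega>. \<integral>y. h (U \<omega>, y) \<partial>K (U \<omega>) \<partial>M)"
proof -
  interpret prob_space M by fact
  have U[measurable]: "U \<in> M \<rightarrow>\<^sub>M A" and V[measurable]: "V \<in> M \<rightarrow>\<^sub>M B" and K: "K \<in> A \<rightarrow>\<^sub>M prob_algebra B"
    and D: "\<And>h. h\<in>borel_measurable (A \<Otimes>\<^sub>M B) \<Longrightarrow>
        (\<integral>\<^sup>+\<omega>. h (U \<omega>, V \<omega>) \<partial>M) = (\<integral>\<^sup>+\<omega>. \<integral>\<^sup>+y. h (U \<omega>, y) \<partial>K (U \<omega>) \<partial>M)"
    using assms(2) by (auto simp: disintegrates_def)
  note [measurable] = measurable_prob_algebraD[OF K]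
  have KU: "prob_space (K (U \<omega>))" "sets (K (U \<omega>)) = sets B" if "\<omega> \<in> space M" for \<omega>
    using measurable_space[OF K measurable_space[OF U that]]
    by (auto simp: space_prob_algebra)
  have bd: "\<bar>h (U \<omega>, y)\<bar> \<le> b" if "\<omega> \<in> space M" "y \<in> space B" for \<omega> y
    using that measurable_space[OF U] by (intro b) (auto simp: space_pair_measure)
  have bV: "\<bar>h (U \<omega>, V \<omega>)\<bar> \<le> b" if "\<omega> \<in> space M" for \<omega>
    using that measurable_space[OF V that] by (intro bd)
  have int1: "integrable M (\<lambda>\<omega>. h (U \<omega>, V \<omega>))"
    using bV by (intro integrable_const_bound[where B=b]) auto
  have hK: "(\<lambda>y. h (U \<omega>, y)) \<in> borel_measurable (K (U \<omega>))" if "\<omega> \<in> space M" for \<omega>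
    using KU(2)[OF that] measurable_space[OF U that] by (simp cong: measurable_cong_sets)
  have intK: "integrable (K (U \<omega>)) (\<lambda>y. h (U \<omega>, y))" if w: "\<omega> \<in> space M" for \<omega>
  proof -
    interpret k: prob_space "K (U \<omega>)" using KU[OF w] by simp
    show ?thesis using bd[OF w] sets_eq_imp_space_eq[OF KU(2)[OF w]] hK[OF w]
      by (intro k.integrable_const_bound[where B=b]) auto
  qed
  have absK: "\<bar>\<integral>y. h (U \<omega>, y) \<partial>K (U \<omega>)\<bar> \<le> b" if w: "\<omega> \<in> space M" for \<omega>
  proof -
    interpret k: prob_space "K (U \<omega>)" using KU[OF w] by simp
    have "\<bar>\<integral>y. h (U \<omega>, y) \<partial>K (U \<omega>)\<bar> \<le> (\<integral>y. \<bar>h (U \<omega>, y)\<bar> \<partial>K (U \<omega>))"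
      by (rule integral_abs_bound)
    also have "\<dots> \<le> (\<integral>y. b \<partial>K (U \<omega>))"
      using bd[OF w] sets_eq_imp_space_eq[OF KU(2)[OF w]] intK[OF w]
      by (intro integral_mono) auto
    finally show ?thesis by (simp add: k.prob_space)
  qed
  have mI[measurable]: "(\<lambda>\<omega>. \<integral>y. h (U \<omega>, y) \<partial>K (U \<omega>)) \<in> borel_measurable M"
    by (rule measurable_compose[OF U kernel_integral_measurable]) (use K in \<open>auto\<close>)
  have int2: "integrable M (\<lambda>\<omega>. \<integral>y. h (U \<omega>, y) \<partial>K (U \<omega>))"
    using absK by (intro integrable_const_bound[where B=b]) auto
  have nn1: "0 \<le> h (U \<omega>, V \<omega>) + b" and nn2: "y \<in> space B \<Longrightarrow> 0 \<le> h (U \<omega>, y) + b"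
    and nn3: "0 \<le> (\<integral>y. h (U \<omega>, y) \<partial>K (U \<omega>)) + b" if "\<omega> \<in> space M" for \<omega> y
    using bV[OF that] bd[OF that, of y] absK[OF that] by linarith+
  have "ennreal (\<integral>\<omega>. h (U \<omega>, V \<omega>) + b \<partial>M) = (\<integral>\<^sup>+\<omega>. ennreal (h (U \<omega>, V \<omega>) + b) \<partial>M)"
    using int1 nn1 by (intro nn_integral_eq_integral[symmetric]) (auto intro!: AE_I2)
  also have "\<dots> = (\<integral>\<^sup>+\<omega>. \<integral>\<^sup>+y. ennreal (h (U \<omega>, y) + b) \<partial>K (U \<omega>) \<partial>M)"
    by (rule D[of "\<lambda>z. ennreal (h z + b)"]) measurable
  also have "\<dots> = (\<integral>\<^sup>+\<omega>. ennreal ((\<integral>y. h (U \<omega>, y) \<partial>K (U \<omega>)) + b) \<partial>M)"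
  proof (rule nn_integral_cong)
    fix \<omega> assume w: "\<omega> \<in> space M"
    interpret k: prob_space "K (U \<omega>)" using KU[OF w] by simp
    have "(\<integral>\<^sup>+y. ennreal (h (U \<omega>, y) + b) \<partial>K (U \<omega>)) = ennreal (\<integral>y. h (U \<omega>, y) + b \<partial>K (U \<omega>))"
      using intK[OF w] nn2[OF w] sets_eq_imp_space_eq[OF KU(2)[OF w]]
      by (intro nn_integral_eq_integral AE_I2) auto
    then show "(\<integral>\<^sup>+y. ennreal (h (U \<omega>, y) + b) \<partial>K (U \<omega>)) = ennreal ((\<integral>y. h (U \<omega>, y) \<partial>K (U \<omega>)) + b)"
      using intK[OF w] by (simp add: k.prob_space)
  qed
  also have "\<dots> = ennreal (\<integral>\<omega>. (\<integral>y. h (U \<omega>, y) \<partial>K (U \<omega>)) + b \<partial>M)"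
    using int2 nn3 by (intro nn_integral_eq_integral AE_I2) auto
  finally have "(\<integral>\<omega>. h (U \<omega>, V \<omega>) + b \<partial>M) = (\<integral>\<omega>. (\<integral>y. h (U \<omega>, y) \<partial>K (U \<omega>)) + b \<partial>M)"
    by (rule ennreal_inj[THEN iffD1, rotated 2])
       (use nn1 nn3 in \<open>auto intro!: integral_nonneg_AE AE_I2\<close>)
  then show ?thesis using int1 int2 by (simp add: prob_space)
qed

section \<open>Exponential moments\<close>

lemma (in prob_space) abs_integral_le_const:
  fixes f :: "'a \<Rightarrow> real"
  assumes "f \<in> borel_measurable M" "\<And>x. x \<in> space M \<Longrightarrow> \<bar>f x\<bar> \<le> b"
  shows "\<bar>\<integral>x. f x \<partial>M\<bar> \<le> b"
proof -
  have "integrable M f"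
    using assms by (intro integrable_const_bound[where B=b]) auto
  then have "(\<integral>x. f x \<partial>M) \<le> b" "- b \<le> (\<integral>x. f x \<partial>M)"
    using assms(2) by (auto intro!: integral_le_const integral_ge_const AE_I2 simp: abs_le_iff minus_le_iff)
  then show ?thesis by linarith
qed

text \<open>An oscillation of at most \<open>d\<close> confines \<open>f\<close> to an interval of
  length \<open>d\<close> that starts at its infimum, and Hoeffding's bound depends only on that
  length. No location of the interval has to be supplied, which is what a fibrewise application
  requires.\<close>

lemma (in prob_space) hoeffding_lemma_oscillation:
  fixes f :: "'a \<Rightarrow> real"
  assumes f[measurable]: "f \<in> borel_measurable M"
    and osc: "\<And>x y. x \<in> space M \<Longrightarrow> y \<in> space M \<Longrightarrow> f x - f y \<le> d"
  shows "(\<integral>x. exp (l * f x) \<partial>M) \<le> exp (l * (\<integral>x. f x \<partial>M) + l\<^sup>2 * d\<^sup>2 / 8)"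
proof -
  \<comment> \<open>Stated for arbitrary \<open>f\<close> and \<open>l > 0\<close>, so that a
    negative \<open>l\<close> is handled by passing to \<open>- f\<close> and \<open>- l\<close>,
    which has the same oscillation.\<close>
  have pos: "(\<integral>x. exp (l * f x) \<partial>M) \<le> exp (l * (\<integral>x. f x \<partial>M) + l\<^sup>2 * d\<^sup>2 / 8)"
    if l: "l > 0" and [measurable]: "f \<in> borel_measurable M"
      and osc: "\<And>x y. x \<in> space M \<Longrightarrow> y \<in> space M \<Longrightarrow> f x - f y \<le> d" for f :: "'a \<Rightarrow> real" and l
  proof -
    define a where "a = Inf (f ` space M)"
    obtain z where z: "z \<in> space M" using not_empty by auto
    have bdd: "bdd_below (f ` space M)"
      using osc[OF z] by (intro bdd_belowI2[where m="f z - d"]) (auto simp: algebra_simps)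
    have bounds: "a \<le> f x" "f x \<le> a + d" if x: "x \<in> space M" for x
    proof -
      show "a \<le> f x" unfolding a_def by (rule cINF_lower[OF bdd x])
      have "f x - d \<le> a"
        unfolding a_def using osc[OF x] by (intro cINF_greatest) (auto simp: not_empty algebra_simps)
      then show "f x \<le> a + d" by simp
    qed
    interpret interval_bounded_random_variable M f a "a + d"
      by unfold_locales (use bounds in \<open>auto intro!: AE_I2\<close>)
    define \<mu> where "\<mu> = expectation f"
    have "ennreal (\<integral>x. exp (l * (f x - \<mu>)) \<partial>M) = (\<integral>\<^sup>+x. ennreal (exp (l * (f x - \<mu>))) \<partial>M)"
    proof (rule nn_integral_eq_integral[symmetric])
      show "integrable M (\<lambda>x. exp (l * (f x - \<mu>)))"
        using bounds l by (intro integrable_const_bound[where B="exp (l * (a + d - \<mu>))"]) (auto intro!: AE_I2)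
    qed auto
    also have "\<dots> \<le> ennreal (exp (l\<^sup>2 * d\<^sup>2 / 8))"
      using Hoeffdings_lemma_nn_integral[OF l] by (simp add: \<mu>_def)
    finally have "(\<integral>x. exp (l * (f x - \<mu>)) \<partial>M) \<le> exp (l\<^sup>2 * d\<^sup>2 / 8)"
      by simp
    also have "(\<lambda>x. exp (l * (f x - \<mu>))) = (\<lambda>x. exp (- (l * \<mu>)) * exp (l * f x))"
      by (auto simp: exp_add[symmetric] algebra_simps)
    finally show ?thesis
      unfolding exp_add \<mu>_def[symmetric] by (simp add: exp_minus field_simps)
  qed
  consider "l > 0" | "l = 0" | "l < 0" by linarith
  then show ?thesis
  proof cases
    case 1 then show ?thesis by (rule pos) fact+
  next
    case 2 then show ?thesis by (simp add: prob_space)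
  next
    case 3 then show ?thesis
      using pos[of "-l" "\<lambda>x. - f x"] osc by (simp add: algebra_simps)
  qed
qed

lemma disintegrates_space:
  assumes "disintegrates M A B U V K" "u \<in> space A"
  shows "prob_space (K u)" "sets (K u) = sets B" "space (K u) = space B"
    "g \<in> borel_measurable (A \<Otimes>\<^sub>M B) \<Longrightarrow> (\<lambda>y. g (u, y)) \<in> borel_measurable (K u)"
proof -
  have K: "K \<in> A \<rightarrow>\<^sub>M prob_algebra B" using assms(1) by (simp add: disintegrates_def)
  show "prob_space (K u)" and eq: "sets (K u) = sets B"
    using measurable_space[OF K assms(2)] by (auto simp: space_prob_algebra)
  then show "space (K u) = space B" by (intro sets_eq_imp_space_eq)
  show "(\<lambda>y. g (u, y)) \<in> borel_measurable (K u)" if "g \<in> borel_measurable (A \<Otimes>\<^sub>M B)"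
    using that assms(2) eq by (simp cong: measurable_cong_sets)
qed

text \<open>Here \<open>\<gamma> (U \<omega>)\<close> is the present value of the martingale and
  \<open>\<phi> (U \<omega>, V \<omega>)\<close> the next one. The versions of the conditional laws
  for different prefixes are chosen separately, so the mean of \<open>\<phi>\<close> in a fibre need
  not equal \<open>\<gamma>\<close> everywhere; hence the martingale property is assumed only in the
  weak form \<open>mart\<close>, tested against bounded functions of \<open>U\<close>.\<close>

lemma (in prob_space) exp_kernel_step:
  fixes \<phi> :: "'b \<times> 'c \<Rightarrow> real" and \<gamma> :: "'b \<Rightarrow> real"
  assumes D: "disintegrates M A B U V K"
    and \<phi>[measurable]: "\<phi> \<in> borel_measurable (A \<Otimes>\<^sub>M B)"
    and \<phi>_bd: "\<And>z. z \<in> space (A \<Otimes>\<^sub>M B) \<Longrightarrow> \<bar>\<phi> z\<bar> \<le> b"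
    and \<gamma>[measurable]: "\<gamma> \<in> borel_measurable A"
    and \<gamma>_bd: "\<And>u. u \<in> space A \<Longrightarrow> \<bar>\<gamma> u\<bar> \<le> b"
    and mart: "\<And>\<psi> b'. \<psi> \<in> borel_measurable A \<Longrightarrow> (\<And>u. u \<in> space A \<Longrightarrow> \<bar>\<psi> u\<bar> \<le> b') \<Longrightarrow>
        (\<integral>\<omega>. \<psi> (U \<omega>) * \<phi> (U \<omega>, V \<omega>) \<partial>M) = (\<integral>\<omega>. \<psi> (U \<omega>) * \<gamma> (U \<omega>) \<partial>M)"
    and osc: "\<And>u y y'. u \<in> space A \<Longrightarrow> y \<in> space B \<Longrightarrow> y' \<in> space B \<Longrightarrow> \<phi> (u, y) - \<phi> (u, y') \<le> d"
  shows "(\<integral>\<omega>. exp (l * \<phi> (U \<omega>, V \<omega>)) \<partial>M) \<le> exp (l\<^sup>2 * d\<^sup>2 / 8) * (\<integral>\<omega>. exp (l * \<gamma> (U \<omega>)) \<partial>M)"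
proof -
  have U[measurable]: "U \<in> M \<rightarrow>\<^sub>M A" and V[measurable]: "V \<in> M \<rightarrow>\<^sub>M B" and K: "K \<in> A \<rightarrow>\<^sub>M prob_algebra B"
    using D by (auto simp: disintegrates_def)
  note Ksp = disintegrates_space[OF D]
  have US: "U \<omega> \<in> space A" if "\<omega> \<in> space M" for \<omega> by (rule measurable_space[OF U that])
  define \<mu> where "\<mu> u = (\<integral>y. \<phi> (u, y) \<partial>K u)" for u
  have [measurable]: "\<mu> \<in> borel_measurable A"
    unfolding \<mu>_def by (rule kernel_integral_measurable[OF K \<phi>])
  have \<mu>_bd: "\<bar>\<mu> u\<bar> \<le> b" if u: "u \<in> space A" for u
    unfolding \<mu>_def using u Ksp(4)[OF u \<phi>]
    by (intro prob_space.abs_integral_le_const[OF Ksp(1)[OF u]] \<phi>_bd) (auto simp: Ksp(3)[OF u] space_pair_measure)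
  have exp_bd: "exp (l * x) \<le> exp (\<bar>l\<bar> * b)" if "\<bar>x\<bar> \<le> b" for x
    using that abs_le_D1[of "l * x" "\<bar>l\<bar> * b"] by (simp add: abs_mult mult_left_mono)
  txt \<open>Testing the martingale property against \<open>\<mu> - \<gamma>\<close> itself gives \<open>\<mu> = \<gamma>\<close> almost surely.\<close>
  define \<psi> where "\<psi> u = \<mu> u - \<gamma> u" for u
  have [measurable]: "\<psi> \<in> borel_measurable A" unfolding \<psi>_def by measurable
  have \<psi>_bd: "\<bar>\<psi> u\<bar> \<le> 2 * b" if "u \<in> space A" for u
    using \<mu>_bd[OF that] \<gamma>_bd[OF that] by (simp add: \<psi>_def)
  have bd2: "\<bar>\<psi> u * x\<bar> \<le> 2 * b * b" if "u \<in> space A" "\<bar>x\<bar> \<le> b" for u x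
    using \<psi>_bd[OF that(1)] that(2) by (simp add: abs_mult mult_mono')
  have "(\<integral>\<omega>. \<psi> (U \<omega>) * \<mu> (U \<omega>) \<partial>M) = (\<integral>\<omega>. \<integral>y. \<psi> (U \<omega>) * \<phi> (U \<omega>, y) \<partial>K (U \<omega>) \<partial>M)"
    by (simp add: \<mu>_def)
  also have "\<dots> = (\<integral>\<omega>. \<psi> (U \<omega>) * \<phi> (U \<omega>, V \<omega>) \<partial>M)"
    by (rule disintegrates_integral[OF prob_space_axioms D, of "\<lambda>z. \<psi> (fst z) * \<phi> z" "2 * b * b",
          unfolded fst_conv, symmetric])
       (auto simp: space_pair_measure intro!: bd2 \<phi>_bd)
  also have "\<dots> = (\<integral>\<omega>. \<psi> (U \<omega>) * \<gamma> (U \<omega>) \<partial>M)"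
    using \<psi>_bd by (intro mart) auto
  finally have "(\<integral>\<omega>. \<psi> (U \<omega>) * \<mu> (U \<omega>) \<partial>M) - (\<integral>\<omega>. \<psi> (U \<omega>) * \<gamma> (U \<omega>) \<partial>M) = 0"
    by simp
  moreover have int: "integrable M (\<lambda>\<omega>. \<psi> (U \<omega>) * \<mu> (U \<omega>))" "integrable M (\<lambda>\<omega>. \<psi> (U \<omega>) * \<gamma> (U \<omega>))"
    using bd2 \<mu>_bd \<gamma>_bd US by (auto intro!: integrable_const_bound[where B="2 * b * b"] AE_I2)
  ultimately have "(\<integral>\<omega>. \<psi> (U \<omega>) * \<mu> (U \<omega>) - \<psi> (U \<omega>) * \<gamma> (U \<omega>) \<partial>M) = 0"
    by (subst Bochner_Integration.integral_diff) auto
  then have "(\<integral>\<omega>. (\<psi> (U \<omega>))\<^sup>2 \<partial>M) = 0"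
    by (simp add: \<psi>_def power2_eq_square algebra_simps)
  moreover have "integrable M (\<lambda>\<omega>. (\<psi> (U \<omega>))\<^sup>2)"
    using Bochner_Integration.integrable_diff[OF int] by (simp add: \<psi>_def power2_eq_square algebra_simps)
  ultimately have AE: "AE \<omega> in M. \<mu> (U \<omega>) = \<gamma> (U \<omega>)"
    by (subst (asm) integral_nonneg_eq_0_iff_AE) (auto simp: \<psi>_def)
  have "(\<integral>\<omega>. exp (l * \<phi> (U \<omega>, V \<omega>)) \<partial>M) = (\<integral>\<omega>. \<integral>y. exp (l * \<phi> (U \<omega>, y)) \<partial>K (U \<omega>) \<partial>M)"
    using exp_bd \<phi>_bd
    by (intro disintegrates_integral[OF prob_space_axioms D, of "\<lambda>z. exp (l * \<phi> z)" "exp (\<bar>l\<bar> * b)"]) auto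
  also have "\<dots> \<le> (\<integral>\<omega>. exp (l\<^sup>2 * d\<^sup>2 / 8) * exp (l * \<gamma> (U \<omega>)) \<partial>M)"
  proof (rule integral_mono_AE)
    have m: "(\<lambda>u. \<integral>y. exp (l * \<phi> (u, y)) \<partial>K u) \<in> borel_measurable A"
      by (rule kernel_integral_measurable[OF K, of "\<lambda>z. exp (l * \<phi> z)"]) measurable
    show "integrable M (\<lambda>\<omega>. \<integral>y. exp (l * \<phi> (U \<omega>, y)) \<partial>K (U \<omega>))"
    proof (rule integrable_const_bound[where B="exp (\<bar>l\<bar> * b)"])
      show "AE \<omega> in M. norm (\<integral>y. exp (l * \<phi> (U \<omega>, y)) \<partial>K (U \<omega>)) \<le> exp (\<bar>l\<bar> * b)"
      proof (rule AE_I2)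
        fix \<omega> assume w: "\<omega> \<in> space M"
        show "norm (\<integral>y. exp (l * \<phi> (U \<omega>, y)) \<partial>K (U \<omega>)) \<le> exp (\<bar>l\<bar> * b)"
          unfolding real_norm_def using Ksp(4)[OF US[OF w], of "\<lambda>z. exp (l * \<phi> z)"] US[OF w]
          by (intro prob_space.abs_integral_le_const[OF Ksp(1)[OF US[OF w]]])
             (auto simp: Ksp(3)[OF US[OF w]] space_pair_measure simp del: exp_le_cancel_iff intro!: exp_bd \<phi>_bd)
      qed
    qed (rule measurable_compose[OF U m])
    show "integrable M (\<lambda>\<omega>. exp (l\<^sup>2 * d\<^sup>2 / 8) * exp (l * \<gamma> (U \<omega>)))"
      using exp_bd \<gamma>_bd US
      by (intro integrable_mult_right integrable_const_bound[where B="exp (\<bar>l\<bar> * b)"]) (auto intro!: AE_I2)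
    show "AE \<omega> in M. (\<integral>y. exp (l * \<phi> (U \<omega>, y)) \<partial>K (U \<omega>)) \<le> exp (l\<^sup>2 * d\<^sup>2 / 8) * exp (l * \<gamma> (U \<omega>))"
      using AE
    proof (rule AE_mp[OF _ AE_I2[OF impI]])
      fix \<omega> assume w: "\<omega> \<in> space M" and eq: "\<mu> (U \<omega>) = \<gamma> (U \<omega>)"
      interpret k: prob_space "K (U \<omega>)" by (rule Ksp(1)[OF US[OF w]])
      \<comment> \<open>Hoeffding's lemma within one fibre. The oscillation bound holds in every
        fibre; only the replacement of the fibre mean \<open>\<mu>\<close> by
        \<open>\<gamma>\<close> is almost sure.\<close>
      have "(\<integral>y. exp (l * \<phi> (U \<omega>, y)) \<partial>K (U \<omega>)) \<le> exp (l * \<mu> (U \<omega>) + l\<^sup>2 * d\<^sup>2 / 8)"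
        unfolding \<mu>_def using Ksp(4)[OF US[OF w] \<phi>] osc[OF US[OF w]]
        by (intro k.hoeffding_lemma_oscillation) (auto simp: Ksp(3)[OF US[OF w]])
      then show "(\<integral>y. exp (l * \<phi> (U \<omega>, y)) \<partial>K (U \<omega>)) \<le> exp (l\<^sup>2 * d\<^sup>2 / 8) * exp (l * \<gamma> (U \<omega>))"
        by (simp add: eq exp_add mult.commute)
    qed
  qed
  finally show ?thesis by simp
qed

text \<open>Isolates what is asked of the coupling: the bound \<open>osc\<close> on the change of
  \<open>g i\<close> under a change of its last argument. Admitting \<open>i = 0\<close> and
  \<open>i = m\<close> in \<open>D\<close> makes the martingale run from the mean of
  \<open>F (Y \<omega>)\<close> to \<open>F (Y \<omega>)\<close> itself.\<close>

theorem exp_moment_kernel_martingale: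
  fixes F :: "(nat \<Rightarrow> 'e) \<Rightarrow> real"
  assumes "prob_space M"
    and Y[measurable]: "Y \<in> M \<rightarrow>\<^sub>M PiM {1..m} E"
    and D: "\<And>i. i \<le> m \<Longrightarrow> disintegrates M (PiM {1..i} E) (PiM {i+1..m} E)
        (\<lambda>\<omega>. restrict (Y \<omega>) {1..i}) (\<lambda>\<omega>. restrict (Y \<omega>) {i+1..m}) (K i)"
    and F[measurable]: "F \<in> borel_measurable (PiM {1..m} E)"
    and F_bd: "\<And>x. x \<in> space (PiM {1..m} E) \<Longrightarrow> \<bar>F x\<bar> \<le> b"
    and g_def: "\<And>i x. g i x = (\<integral>y. F (merge {1..i} {i+1..m} (x, y)) \<partial>K i x)"
    and osc: "\<And>i x x'. i \<in> {1..m} \<Longrightarrow> x \<in> space (PiM {1..i} E) \<Longrightarrow> x' \<in> space (E i) \<Longrightarrow>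
        g i x - g i (x(i := x')) \<le> d i"
  shows "(\<integral>\<omega>. exp (l * (F (Y \<omega>) - (\<integral>\<omega>. F (Y \<omega>) \<partial>M))) \<partial>M) \<le> exp (l\<^sup>2 * (\<Sum>i=1..m. (d i)\<^sup>2) / 8)"
proof -
  interpret prob_space M by fact
  have YS: "Y \<omega> \<in> space (PiM {1..m} E)" if "\<omega> \<in> space M" for \<omega>
    by (rule measurable_space[OF Y that])
  have merge_measurable[measurable]: "merge {1..i} {i+1..m} \<in> PiM {1..i} E \<Otimes>\<^sub>M PiM {i+1..m} E \<rightarrow>\<^sub>M PiM {1..m} E"
    if "i \<le> m" for i
  proof -
    have "{1..i} \<union> {i+1..m} = {1..m}" using that by auto
    then show ?thesis using measurable_merge[of "{1..i}" "{i+1..m}" E] by simp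
  qed
  have Fm: "(\<lambda>z. F (merge {1..i} {i+1..m} z)) \<in> borel_measurable (PiM {1..i} E \<Otimes>\<^sub>M PiM {i+1..m} E)"
    if "i \<le> m" for i
    by (rule measurable_compose[OF merge_measurable[OF that] F])
  have FmB: "\<bar>F (merge {1..i} {i+1..m} z)\<bar> \<le> b"
    if "i \<le> m" "z \<in> space (PiM {1..i} E \<Otimes>\<^sub>M PiM {i+1..m} E)" for i z
    by (rule F_bd[OF measurable_space[OF merge_measurable[OF that(1)] that(2)]])
  have K: "K i \<in> PiM {1..i} E \<rightarrow>\<^sub>M prob_algebra (PiM {i+1..m} E)" if "i \<le> m" for i
    using D[OF that] by (simp add: disintegrates_def)
  have Yr[measurable]: "(\<lambda>\<omega>. restrict (Y \<omega>) {1..i}) \<in> M \<rightarrow>\<^sub>M PiM {1..i} E" if "i \<le> m" for i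
    using D[OF that] by (simp add: disintegrates_def)
  have g_m: "g i \<in> borel_measurable (PiM {1..i} E)" if "i \<le> m" for i
    unfolding g_def by (rule kernel_integral_measurable[OF K[OF that] Fm[OF that]])
  have g_bd: "\<bar>g i x\<bar> \<le> b" if i: "i \<le> m" and x: "x \<in> space (PiM {1..i} E)" for i x
    unfolding g_def using disintegrates_space[OF D[OF i] x] Fm[OF i] x
    by (intro prob_space.abs_integral_le_const FmB[OF i]) (auto simp: space_pair_measure)
  have merge_Y: "merge {1..i} {i+1..m} (restrict (Y \<omega>) {1..i}, restrict (Y \<omega>) {i+1..m}) = Y \<omega>"
    if "i \<le> m" "\<omega> \<in> space M" for i \<omega>
  proof -
    have "{1..i} \<union> {i+1..m} = {1..m}" using that by auto
    then show ?thesis using YS[OF that(2)] by (simp add: space_PiM PiE_restrict)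
  qed
  \<comment> \<open>The values of \<open>g i\<close> form a version of the conditional expectation
    of \<open>F (Y \<omega>)\<close> given the first \<open>i\<close> coordinates, in weak form. The
    factor \<open>\<psi>\<close> joins the test function of the disintegration and is constant in
    the inner integral.\<close>
  have mart: "(\<integral>\<omega>. \<psi> (restrict (Y \<omega>) {1..i}) * g i (restrict (Y \<omega>) {1..i}) \<partial>M)
      = (\<integral>\<omega>. \<psi> (restrict (Y \<omega>) {1..i}) * F (Y \<omega>) \<partial>M)"
    if i: "i \<le> m" and [measurable]: "\<psi> \<in> borel_measurable (PiM {1..i} E)"
      and bd: "\<And>x. x \<in> space (PiM {1..i} E) \<Longrightarrow> \<bar>\<psi> x\<bar> \<le> b'" for i \<psi> b'
  proof -
    note [measurable] = Fm[OF i]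
    have "(\<integral>\<omega>. \<psi> (restrict (Y \<omega>) {1..i}) * F (Y \<omega>) \<partial>M) = 
      (\<integral>\<omega>. \<psi> (restrict (Y \<omega>) {1..i}) * F (merge {1..i} {i+1..m} (restrict (Y \<omega>) {1..i}, restrict (Y \<omega>) {i+1..m})) \<partial>M)"
      by (intro Bochner_Integration.integral_cong refl) (simp only: merge_Y[OF i])
    also have "\<dots> = (\<integral>\<omega>. \<integral>y. \<psi> (restrict (Y \<omega>) {1..i}) * F (merge {1..i} {i+1..m} (restrict (Y \<omega>) {1..i}, y)) \<partial>K i (restrict (Y \<omega>) {1..i}) \<partial>M)"
    proof (rule disintegrates_integral[OF prob_space_axioms D[OF i],
        of "\<lambda>z. \<psi> (fst z) * F (merge {1..i} {i+1..m} z)" "b' * b", unfolded fst_conv])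
      fix z assume z: "z \<in> space (PiM {1..i} E \<Otimes>\<^sub>M PiM {i+1..m} E)"
      then have "fst z \<in> space (PiM {1..i} E)" by (auto simp: space_pair_measure)
      then show "\<bar>\<psi> (fst z) * F (merge {1..i} {i+1..m} z)\<bar> \<le> b' * b"
        using FmB[OF i z] bd[of "fst z"] by (simp add: abs_mult mult_mono')
    qed measurable
    also have "\<dots> = (\<integral>\<omega>. \<psi> (restrict (Y \<omega>) {1..i}) * g i (restrict (Y \<omega>) {1..i}) \<partial>M)"
      by (simp add: g_def)
    finally show ?thesis by simp
  qed
  have step: "(\<integral>\<omega>. exp (l * g (Suc k) (restrict (Y \<omega>) {1..Suc k})) \<partial>M)
      \<le> exp (l\<^sup>2 * (d (Suc k))\<^sup>2 / 8) * (\<integral>\<omega>. exp (l * g k (restrict (Y \<omega>) {1..k})) \<partial>M)" if k: "Suc k \<le> m" for k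
  proof -
    have k': "k \<le> m" using k by simp
    \<comment> \<open>\<open>g (Suc k)\<close> looks at only one coordinate of the tail. Appending
      that coordinate to the prefix by \<open>upd\<close> lets the whole tail act as
      \<open>V\<close>, so \<open>K k\<close> is used without forming a marginal.\<close>
    define upd :: "(nat \<Rightarrow> 'e) \<times> (nat \<Rightarrow> 'e) \<Rightarrow> nat \<Rightarrow> 'e"
      where "upd z = (fst z)(Suc k := snd z (Suc k))" for z
    have upd[measurable]: "upd \<in> PiM {1..k} E \<Otimes>\<^sub>M PiM {k+1..m} E \<rightarrow>\<^sub>M PiM {1..Suc k} E"
      unfolding upd_def using k
      by (intro measurable_fun_upd[where J="{1..k}"]) (auto intro!: measurable_compose[OF measurable_snd])
    have upd_eq: "upd (restrict (Y \<omega>) {1..k}, restrict (Y \<omega>) {k+1..m}) = restrict (Y \<omega>) {1..Suc k}" for \<omega>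
      using k by (auto simp: upd_def fun_eq_iff)
    have "(\<integral>\<omega>. exp (l * g (Suc k) (upd (restrict (Y \<omega>) {1..k}, restrict (Y \<omega>) {k+1..m}))) \<partial>M)
      \<le> exp (l\<^sup>2 * (d (Suc k))\<^sup>2 / 8) * (\<integral>\<omega>. exp (l * g k (restrict (Y \<omega>) {1..k})) \<partial>M)"
    proof (rule exp_kernel_step[OF D[OF k'], where b=b])
      show "(\<lambda>z. g (Suc k) (upd z)) \<in> borel_measurable (PiM {1..k} E \<Otimes>\<^sub>M PiM {k+1..m} E)"
        by (rule measurable_compose[OF upd g_m[OF k]])
      show "\<bar>g (Suc k) (upd z)\<bar> \<le> b" if "z \<in> space (PiM {1..k} E \<Otimes>\<^sub>M PiM {k+1..m} E)" for z
        by (rule g_bd[OF k measurable_space[OF upd that]])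
      show "g k \<in> borel_measurable (PiM {1..k} E)" by (rule g_m[OF k'])
      show "\<bar>g k u\<bar> \<le> b" if "u \<in> space (PiM {1..k} E)" for u by (rule g_bd[OF k' that])
    next
      fix \<psi> :: "(nat \<Rightarrow> 'e) \<Rightarrow> real" and b'
      assume \<psi>: "\<psi> \<in> borel_measurable (PiM {1..k} E)" "\<And>u. u \<in> space (PiM {1..k} E) \<Longrightarrow> \<bar>\<psi> u\<bar> \<le> b'"
      \<comment> \<open>A function of the first \<open>k\<close> coordinates is also one of the
        first \<open>Suc k\<close>, so \<open>mart\<close> applies to the same \<open>\<psi>\<close>
        at both levels. Comparing the two through \<open>F (Y \<omega>)\<close> is the tower
        property.\<close>
      have res: "(\<lambda>x. restrict x {1..k}) \<in> PiM {1..Suc k} E \<rightarrow>\<^sub>M PiM {1..k} E"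
        by (rule measurable_restrict_subset) auto
      have rr: "restrict (restrict (Y \<omega>) {1..Suc k}) {1..k} = restrict (Y \<omega>) {1..k}" for \<omega>
        by (auto simp: fun_eq_iff)
      have "(\<integral>\<omega>. \<psi> (restrict (Y \<omega>) {1..k}) * g (Suc k) (restrict (Y \<omega>) {1..Suc k}) \<partial>M)
          = (\<integral>\<omega>. \<psi> (restrict (Y \<omega>) {1..k}) * F (Y \<omega>) \<partial>M)"
        using mart[OF k measurable_compose[OF res \<psi>(1)], of b'] \<psi>(2) measurable_space[OF res]
        by (simp only: rr)
      also have "\<dots> = (\<integral>\<omega>. \<psi> (restrict (Y \<omega>) {1..k}) * g k (restrict (Y \<omega>) {1..k}) \<partial>M)"
        using mart[OF k' \<psi>] by simp
      finally show "(\<integral>\<omega>. \<psi> (restrict (Y \<omega>) {1..k}) * g (Suc k) (upd (restrict (Y \<omega>) {1..k}, restrict (Y \<omega>) {k+1..m})) \<partial>M)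
          = (\<integral>\<omega>. \<psi> (restrict (Y \<omega>) {1..k}) * g k (restrict (Y \<omega>) {1..k}) \<partial>M)"
        by (simp only: upd_eq)
    next
      fix u y y' assume u: "u \<in> space (PiM {1..k} E)" and y: "y \<in> space (PiM {k+1..m} E)" "y' \<in> space (PiM {k+1..m} E)"
      have "upd (u, y) \<in> space (PiM {1..Suc k} E)"
        using u y by (intro measurable_space[OF upd]) (auto simp: space_pair_measure)
      moreover have "y' (Suc k) \<in> space (E (Suc k))"
        using y(2) k by (auto simp: space_PiM)
      \<comment> \<open>With the prefix \<open>u\<close> fixed, the two arguments differ at
        \<open>Suc k\<close> only, which is the situation of \<open>osc\<close>.\<close>
      moreover have "upd (u, y') = (upd (u, y))(Suc k := y' (Suc k))"
        by (simp add: upd_def)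
      ultimately show "g (Suc k) (upd (u, y)) - g (Suc k) (upd (u, y')) \<le> d (Suc k)"
        using osc[of "Suc k" "upd (u, y)" "y' (Suc k)"] k by simp
    qed
    then show ?thesis by (simp only: upd_eq)
  qed
  have ind: "(\<integral>\<omega>. exp (l * g k (restrict (Y \<omega>) {1..k})) \<partial>M)
      \<le> exp (l\<^sup>2 * (\<Sum>i=1..k. (d i)\<^sup>2) / 8) * exp (l * (\<integral>\<omega>. F (Y \<omega>) \<partial>M))" if "k \<le> m" for k
    using that
  proof (induction k)
    case 0
    \<comment> \<open>The empty prefix is the constant function \<open>undefined\<close>, so
      \<open>g 0\<close> contributes a single number; \<open>mart\<close> with
      \<open>\<psi> = 1\<close> identifies it as the mean.\<close>
    have r0: "restrict (Y \<omega>) {1..0} = (\<lambda>_. undefined)" for \<omega> by (auto simp: fun_eq_iff)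
    have "g 0 (\<lambda>_. undefined) = (\<integral>\<omega>. F (Y \<omega>) \<partial>M)"
      using mart[of 0 "\<lambda>_. 1" 1] unfolding r0 by (simp add: prob_space)
    then show ?case unfolding r0 by (simp add: prob_space)
  next
    case (Suc k)
    have "(\<integral>\<omega>. exp (l * g (Suc k) (restrict (Y \<omega>) {1..Suc k})) \<partial>M)
      \<le> exp (l\<^sup>2 * (d (Suc k))\<^sup>2 / 8) * (exp (l\<^sup>2 * (\<Sum>i=1..k. (d i)\<^sup>2) / 8) * exp (l * (\<integral>\<omega>. F (Y \<omega>) \<partial>M)))"
      using Suc.prems by (intro order_trans[OF step[OF Suc.prems]] mult_left_mono Suc.IH) auto
    also have "\<dots> = exp (l\<^sup>2 * (\<Sum>i=1..Suc k. (d i)\<^sup>2) / 8) * exp (l * (\<integral>\<omega>. F (Y \<omega>) \<partial>M))"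
      by (simp add: exp_add[symmetric] field_simps)
    finally show ?case .
  qed
  \<comment> \<open>At the top level the tail is empty, so the integrand is the constant
    \<open>F x\<close> and the kernel has mass one.\<close>
  have g_top: "g m x = F x" if x: "x \<in> space (PiM {1..m} E)" for x
  proof -
    have "merge {1..m} {m+1..m} (x, y) = x" for y
      using x by (auto simp: merge_def fun_eq_iff space_PiM PiE_def extensional_def)
    then show ?thesis
      using prob_space.prob_space[OF disintegrates_space(1)[OF D x]] by (simp add: g_def)
  qed
  have "(\<integral>\<omega>. exp (l * g m (restrict (Y \<omega>) {1..m})) \<partial>M) = (\<integral>\<omega>. exp (l * F (Y \<omega>)) \<partial>M)"
  proof (intro Bochner_Integration.integral_cong refl)
    fix \<omega> assume w: "\<omega> \<in> space M"
    have "restrict (Y \<omega>) {1..m} = Y \<omega>" using YS[OF w] unfolding space_PiM by (rule PiE_restrict)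
    then show "exp (l * g m (restrict (Y \<omega>) {1..m})) = exp (l * F (Y \<omega>))"
      using g_top[OF YS[OF w]] by simp
  qed
  with ind[of m] have le: "(\<integral>\<omega>. exp (l * F (Y \<omega>)) \<partial>M)
      \<le> exp (l\<^sup>2 * (\<Sum>i=1..m. (d i)\<^sup>2) / 8) * exp (l * (\<integral>\<omega>. F (Y \<omega>) \<partial>M))" by simp
  have "(\<lambda>\<omega>. exp (l * (F (Y \<omega>) - (\<integral>\<omega>. F (Y \<omega>) \<partial>M)))) =
      (\<lambda>\<omega>. exp (l * F (Y \<omega>)) / exp (l * (\<integral>\<omega>. F (Y \<omega>) \<partial>M)))"
    by (simp add: exp_diff right_diff_distrib)
  then show ?thesis using le by (simp add: divide_le_eq)
qed

section \<open>Tail bounds from exponential moments\<close>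

text \<open>Chernoff's inequality for the upper and for the lower tail; the union of the two events
  accounts for the factor 2.\<close>

lemma (in prob_space) subgaussian_two_sided_tail:
  fixes Z :: "'a \<Rightarrow> real"
  assumes int: "\<And>l. integrable M (\<lambda>\<omega>. exp (l * Z \<omega>))"
    and mgf: "\<And>l. (\<integral>\<omega>. exp (l * Z \<omega>) \<partial>M) \<le> exp (l\<^sup>2 * s / 8)"
    and Z[measurable]: "Z \<in> borel_measurable M" and "0 \<le> s" "0 \<le> t"
  shows "measure M {\<omega> \<in> space M. t \<le> \<bar>Z \<omega>\<bar>} \<le> 2 * exp (- 2 * t\<^sup>2 / s)"
\<comment> \<open>Division by zero yields 0, so in both degenerate cases the exponent vanishes and
  the right side is 2.\<close>
proof (cases "s = 0 \<or> t = 0")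
  case True
  then have "2 * exp (- 2 * t\<^sup>2 / s) = 2" by auto
  with prob_le_1[of "{\<omega> \<in> space M. t \<le> \<bar>Z \<omega>\<bar>}"] show ?thesis by linarith
next
  case False
  then have s: "s > 0" and t: "t > 0" using assms by auto
  \<comment> \<open>The minimiser of \<open>- l * t + l\<^sup>2 * s / 8\<close>.\<close>
  define l where "l = 4 * t / s"
  have l: "l > 0" using s t by (simp add: l_def)
  have l_eq: "- l * t + l\<^sup>2 * s / 8 = - 2 * t\<^sup>2 / s"
    using s by (simp add: l_def field_simps power2_eq_square)
  have si: "set_integrable M (space M) (\<lambda>\<omega>. exp (l * Z \<omega>))" for l
    using int[of l] unfolding set_integrable_def by (rule Bochner_Integration.integrable_cong[THEN iffD1, rotated 2]) auto
  have "measure M {\<omega> \<in> space M. t \<le> Z \<omega>} \<le> exp (- l * t) * (\<integral>\<omega>. exp (l * Z \<omega>) \<partial>M)"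
    using Chernoff_ineq_ge[OF l si, of t] by (simp add: set_integral_space int)
  also have "\<dots> \<le> exp (- l * t) * exp (l\<^sup>2 * s / 8)" by (intro mult_left_mono mgf) auto
  also have "\<dots> = exp (- 2 * t\<^sup>2 / s)" by (simp only: exp_add[symmetric] l_eq power2_minus)
  finally have 1: "measure M {\<omega> \<in> space M. t \<le> Z \<omega>} \<le> exp (- 2 * t\<^sup>2 / s)" .
  have "measure M {\<omega> \<in> space M. Z \<omega> \<le> - t} \<le> exp (- l * t) * (\<integral>\<omega>. exp (- l * Z \<omega>) \<partial>M)"
    using Chernoff_ineq_le[OF l si, of "-t"] int[of "-l"] by (simp add: set_integral_space)
  also have "\<dots> \<le> exp (- l * t) * exp ((- l)\<^sup>2 * s / 8)" by (intro mult_left_mono mgf) auto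
  also have "\<dots> = exp (- 2 * t\<^sup>2 / s)" by (simp only: exp_add[symmetric] l_eq power2_minus)
  finally have 2: "measure M {\<omega> \<in> space M. Z \<omega> \<le> - t} \<le> exp (- 2 * t\<^sup>2 / s)" .
  have "{\<omega> \<in> space M. t \<le> \<bar>Z \<omega>\<bar>} = {\<omega> \<in> space M. t \<le> Z \<omega>} \<union> {\<omega> \<in> space M. Z \<omega> \<le> - t}"
    by auto
  then have "measure M {\<omega> \<in> space M. t \<le> \<bar>Z \<omega>\<bar>} \<le>
      measure M {\<omega> \<in> space M. t \<le> Z \<omega>} + measure M {\<omega> \<in> space M. Z \<omega> \<le> - t}"
    by (simp add: measure_Un_le)
  with 1 2 show ?thesis by simp
qed

section \<open>Marton couplings\<close>

text \<open>The balls of radius \<open>1 / (n + 1)\<close> around the points of a countable dense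
  set separate points. Countability is what later turns disagreement into a countable union.\<close>

lemma polish_countable_separating:
  assumes "polish_topology T"
  shows "\<exists>S. countable S \<and> (\<forall>U\<in>S. openin T U) \<and>
    (\<forall>x\<in>topspace T. \<forall>y\<in>topspace T. x \<noteq> y \<longrightarrow> (\<exists>U\<in>S. x \<in> U \<and> y \<notin> U))"
proof -
  obtain M d where "Metric_space M d" and T: "T = Metric_space.mtopology M d"
    using assms by (auto simp: polish_topology_def completely_metrizable_space_def)
  interpret Metric_space M d by fact
  obtain D where D: "countable D" "D \<subseteq> M" "mtopology closure_of D = M"
    using assms by (auto simp: polish_topology_def separable_topology_def T)
  define S where "S = (\<lambda>(a, n). mball a (1 / real (Suc n))) ` (D \<times> UNIV)"
  show ?thesis
  proof (intro exI[of _ S] conjI ballI impI)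
    show "countable S" using D(1) by (simp add: S_def)
    show "openin T U" if "U \<in> S" for U using that by (auto simp: S_def T)
    fix x y assume xy: "x \<in> topspace T" "y \<in> topspace T" "x \<noteq> y"
    then have M: "x \<in> M" "y \<in> M" and "0 < d x y / 2" by (auto simp: T)
    \<comment> \<open>With a radius below half the distance, a ball that contains \<open>x\<close>
      cannot reach \<open>y\<close>, by the triangle inequality through its centre.\<close>
    then obtain n where n: "1 / real (Suc n) < d x y / 2"
      using nat_approx_posE by (metis (no_types))
    have "x \<in> mtopology closure_of D" using M D by simp
    then have "\<forall>r>0. \<exists>a\<in>D. a \<in> mball x r"
      unfolding metric_closure_of by blast
    then obtain a where a: "a \<in> D" "a \<in> mball x (1 / real (Suc n))"
      by (meson divide_pos_pos of_nat_0_less_iff zero_less_Suc zero_less_one)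
    then have "x \<in> mball a (1 / real (Suc n))" by (auto simp: commute)
    moreover have "y \<notin> mball a (1 / real (Suc n))"
      using n a(2) M triangle[of x a y] by auto
    ultimately show "\<exists>U\<in>S. x \<in> U \<and> y \<notin> U"
      using a(1) by (auto simp: S_def)
  qed
qed

lemma space_borel_of [simp]: "space (borel_of T) = topspace T"
  unfolding borel_of_def by (rule space_measure_of) (auto dest: openin_subset)

lemma openin_sets_borel_of: "openin T U \<Longrightarrow> U \<in> sets (borel_of T)"
  unfolding borel_of_def by (subst sets_measure_of) (auto dest: openin_subset)

text \<open>Two different values are told apart by one of countably many open sets, so the event is
  a countable union of measurable ones. This matters because \<open>measure\<close> is 0 on
  non-measurable sets, and the entries of the mixing matrix would then say nothing about
  disagreement.\<close>

lemma neq_measurable_borel_of: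
  assumes "polish_topology T" and f: "f \<in> Q \<rightarrow>\<^sub>M borel_of T" and g: "g \<in> Q \<rightarrow>\<^sub>M borel_of T"
  shows "{\<omega> \<in> space Q. f \<omega> \<noteq> g \<omega>} \<in> sets Q"
proof -
  obtain S where S: "countable S" "\<forall>U\<in>S. openin T U"
    "\<forall>x\<in>topspace T. \<forall>y\<in>topspace T. x \<noteq> y \<longrightarrow> (\<exists>U\<in>S. x \<in> U \<and> y \<notin> U)"
    using polish_countable_separating[OF assms(1)] by (elim exE conjE)
  have "{\<omega> \<in> space Q. f \<omega> \<noteq> g \<omega>} = (\<Union>U\<in>S. f -` U \<inter> space Q - (g -` U \<inter> space Q))"
  proof (intro equalityI subsetI)
    fix \<omega> assume \<omega>: "\<omega> \<in> {\<omega> \<in> space Q. f \<omega> \<noteq> g \<omega>}"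
    then have "f \<omega> \<in> topspace T" "g \<omega> \<in> topspace T"
      using measurable_space[OF f] measurable_space[OF g] by auto
    with S(3) \<omega> obtain U where "U \<in> S" "f \<omega> \<in> U" "g \<omega> \<notin> U" by blast
    with \<omega> show "\<omega> \<in> (\<Union>U\<in>S. f -` U \<inter> space Q - (g -` U \<inter> space Q))" by blast
  qed auto
  also have "\<dots> \<in> sets Q"
    using S(2) by (intro sets.countable_UN'[OF S(1)])
      (auto intro!: sets.Diff measurable_sets[OF f] measurable_sets[OF g] openin_sets_borel_of)
  finally show ?thesis .
qed

lemma neq_measurable_PiM:
  assumes "finite J"
    and comp: "\<And>j f g. j \<in> J \<Longrightarrow> f \<in> Q \<rightarrow>\<^sub>M A j \<Longrightarrow> g \<in> Q \<rightarrow>\<^sub>M A j \<Longrightarrow> {\<omega> \<in> space Q. f \<omega> \<noteq> g \<omega>} \<in> sets Q"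
    and f: "f \<in> Q \<rightarrow>\<^sub>M PiM J A" and g: "g \<in> Q \<rightarrow>\<^sub>M PiM J A"
  shows "{\<omega> \<in> space Q. f \<omega> \<noteq> g \<omega>} \<in> sets Q"
proof -
  have "f \<omega> = g \<omega> \<longleftrightarrow> (\<forall>j\<in>J. f \<omega> j = g \<omega> j)" if "\<omega> \<in> space Q" for \<omega>
    using measurable_space[OF f that] measurable_space[OF g that]
    by (auto simp: space_PiM intro: PiE_ext)
  then have "{\<omega> \<in> space Q. f \<omega> \<noteq> g \<omega>} = (\<Union>j\<in>J. {\<omega> \<in> space Q. f \<omega> j \<noteq> g \<omega> j})" by auto
  also have "\<dots> \<in> sets Q"
    using assms(1) by (intro sets.finite_UN comp measurable_compose[OF f] measurable_compose[OF g]) auto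
  finally show ?thesis .
qed

section \<open>From couplings to oscillation bounds\<close>

text \<open>A coupled vector \<open>W\<close> has head \<open>x\<close> almost surely and a tail of
  law \<open>R\<close>, so it is almost surely the merge of \<open>x\<close> with its own tail; the
  rest is a change of variables. It serves both halves of a coupling, with heads \<open>x\<close>
  and \<open>x(i := x')\<close>.\<close>

lemma integral_merge_coupling:
  fixes F :: "(nat \<Rightarrow> 'e) \<Rightarrow> real"
  assumes i: "i \<le> n" and x: "x \<in> space (PiM {1..i} E)"
    and W: "W \<in> Q \<rightarrow>\<^sub>M PiM {1..n} E"
    and F: "F \<in> borel_measurable (PiM {1..n} E)"
    and head: "AE \<omega> in Q. \<forall>k\<in>{1..i}. W \<omega> k = x k"
    and tail: "distr Q (PiM {i+1..n} E) (\<lambda>\<omega>. restrict (W \<omega>) {i+1..n}) = R"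
  shows "(\<integral>y. F (merge {1..i} {i+1..n} (x, y)) \<partial>R) = (\<integral>\<omega>. F (W \<omega>) \<partial>Q)"
proof -
  have eq: "{1..i} \<union> {i+1..n} = {1..n}" using i by auto
  have "merge {1..i} {i+1..n} \<in> PiM {1..i} E \<Otimes>\<^sub>M PiM {i+1..n} E \<rightarrow>\<^sub>M PiM {1..n} E"
    using measurable_merge[of "{1..i}" "{i+1..n}" E] by (simp only: eq)
  from measurable_compose[OF measurable_Pair1'[OF x] measurable_compose[OF this F]]
  have Fx: "(\<lambda>y. F (merge {1..i} {i+1..n} (x, y))) \<in> borel_measurable (PiM {i+1..n} E)" .
  have r: "(\<lambda>\<omega>. restrict (W \<omega>) {i+1..n}) \<in> Q \<rightarrow>\<^sub>M PiM {i+1..n} E"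
    using i by (intro measurable_compose[OF W measurable_restrict_subset]) auto
  have "(\<integral>y. F (merge {1..i} {i+1..n} (x, y)) \<partial>R)
      = (\<integral>\<omega>. F (merge {1..i} {i+1..n} (x, restrict (W \<omega>) {i+1..n})) \<partial>Q)"
    unfolding tail[symmetric] by (rule integral_distr[OF r Fx])
  also have "\<dots> = (\<integral>\<omega>. F (W \<omega>) \<partial>Q)"
  proof (rule integral_cong_AE)
    show "(\<lambda>\<omega>. F (merge {1..i} {i+1..n} (x, restrict (W \<omega>) {i+1..n}))) \<in> borel_measurable Q"
      by (rule measurable_compose[OF r Fx])
    show "(\<lambda>\<omega>. F (W \<omega>)) \<in> borel_measurable Q" by (rule measurable_compose[OF W F])
    show "AE \<omega> in Q. F (merge {1..i} {i+1..n} (x, restrict (W \<omega>) {i+1..n})) = F (W \<omega>)"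
      using head
    proof (rule AE_mp[OF _ AE_I2[OF impI]])
      fix \<omega> assume w: "\<omega> \<in> space Q" and h: "\<forall>k\<in>{1..i}. W \<omega> k = x k"
      have "merge {1..i} {i+1..n} (x, restrict (W \<omega>) {i+1..n}) k = W \<omega> k" for k
        using h i measurable_space[OF W w]
        by (cases "k \<in> {1..n}") (auto simp: merge_def space_PiM PiE_def extensional_def)
      then have "merge {1..i} {i+1..n} (x, restrict (W \<omega>) {i+1..n}) = W \<omega>" by blast
      then show "F (merge {1..i} {i+1..n} (x, restrict (W \<omega>) {i+1..n})) = F (W \<omega>)" by simp
    qed
  qed
  finally show ?thesis .
qed

text \<open>Below the diagonal both vectors agree with \<open>x\<close> almost surely, which matches
  the entry 0; on it the entry 1 bounds any probability; above it the entry is the supremum.\<close>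

lemma prob_neq_le_mixing_matrix:
  assumes coup: "marton_coupling n E L P V V'" and i: "i \<in> {1..n}" and j: "j \<in> {1..n}"
    and x: "x \<in> (\<Pi>\<^sub>E k\<in>{1..i}. space (E k))" and x': "x' \<in> space (E i)"
  shows "measure (P i x x') {\<omega> \<in> space (P i x x'). V i x x' \<omega> j \<noteq> V' i x x' \<omega> j}
    \<le> mixing_matrix E P V V' i j"
proof -
  have c: "prob_space (P i x x')"
     "AE \<omega> in P i x x'. (\<forall>k\<in>{1..i}. V i x x' \<omega> k = x k) \<and>
           (\<forall>k\<in>{1..<i}. V' i x x' \<omega> k = x k) \<and> V' i x x' \<omega> i = x'"
    if "x \<in> (\<Pi>\<^sub>E k\<in>{1..i}. space (E k))" "x' \<in> space (E i)" for x x'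
    using coup that i unfolding marton_coupling_def by blast+
  have le1: "measure (P i x x') S \<le> 1"
    if "x \<in> (\<Pi>\<^sub>E k\<in>{1..i}. space (E k))" "x' \<in> space (E i)" for x x' S
    using prob_space.prob_le_1[OF c(1)[OF that]] .
  consider "j < i" | "j = i" | "i < j" by linarith
  then show ?thesis
  proof cases
    case 1
    have "AE \<omega> in P i x x'. \<not> V i x x' \<omega> j \<noteq> V' i x x' \<omega> j"
      by (rule eventually_mono[OF c(2)[OF x x']]) (use 1 j in auto)
    then have "measure (P i x x') {\<omega> \<in> space (P i x x'). V i x x' \<omega> j \<noteq> V' i x x' \<omega> j} = 0"
      by (rule prob_space.prob_eq_0_AE[OF c(1)[OF x x']])
    then show ?thesis using 1 by (simp add: mixing_matrix_def)
  next
    case 2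
    then show ?thesis using le1[OF x x'] by (simp add: mixing_matrix_def)
  next
    case 3
    let ?m = "\<lambda>(x, x'). measure (P i x x') {\<omega> \<in> space (P i x x'). V i x x' \<omega> j \<noteq> V' i x x' \<omega> j}"
    \<comment> \<open>A real supremum is an upper bound only for a set that is bounded above;
      probabilities are bounded by 1.\<close>
    have "bdd_above (?m ` ((\<Pi>\<^sub>E k\<in>{1..i}. space (E k)) \<times> space (E i)))"
      using le1 by (intro bdd_aboveI2[where M=1]) auto
    then have "?m (x, x') \<le> Sup (?m ` ((\<Pi>\<^sub>E k\<in>{1..i}. space (E k)) \<times> space (E i)))"
      using x x' by (intro cSUP_upper) auto
    then show ?thesis using 3 by (simp add: mixing_matrix_def)
  qed
qed

text \<open>The coupling realises both conditional means on one probability space, so their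
  difference is the mean of \<open>F (W \<omega>) - F (W' \<omega>)\<close>. The Lipschitz condition
  bounds this by the weighted disagreement probabilities, hence by row \<open>i\<close> of the
  mixing matrix applied to \<open>C\<close>. Since the tails have exactly the laws
  \<open>L i x\<close> and \<open>L i (x(i := x'))\<close>, the bound holds for every
  \<open>x\<close> and \<open>x'\<close>.\<close>

lemma marton_coupling_oscillation:
  fixes F :: "(nat \<Rightarrow> 'e) \<Rightarrow> real" and P :: "nat \<Rightarrow> (nat \<Rightarrow> 'e) \<Rightarrow> 'e \<Rightarrow> 'c measure"
  assumes coup: "marton_coupling n E L P V V'"
    and F: "F \<in> borel_measurable (PiM {1..n} E)"
    and bd: "\<And>z. z \<in> space (PiM {1..n} E) \<Longrightarrow> \<bar>F z\<bar> \<le> b"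
    and lip: "\<And>z w. z \<in> space (PiM {1..n} E) \<Longrightarrow> w \<in> space (PiM {1..n} E) \<Longrightarrow>
       F z - F w \<le> (\<Sum>j=1..n. C j * of_bool (z j \<noteq> w j))"
    and C: "\<And>j. j \<in> {1..n} \<Longrightarrow> 0 \<le> C j"
    and neq: "\<And>j (Q :: 'c measure) f g. j \<in> {1..n} \<Longrightarrow> f \<in> Q \<rightarrow>\<^sub>M E j \<Longrightarrow> g \<in> Q \<rightarrow>\<^sub>M E j \<Longrightarrow>
       {\<omega> \<in> space Q. f \<omega> \<noteq> g \<omega>} \<in> sets Q"
    and i: "i \<in> {1..n}" and x: "x \<in> space (PiM {1..i} E)" and x': "x' \<in> space (E i)"
  shows "(\<integral>y. F (merge {1..i} {i+1..n} (x, y)) \<partial>L i x)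
    - (\<integral>y. F (merge {1..i} {i+1..n} (x(i := x'), y)) \<partial>L i (x(i := x')))
    \<le> mat_vec n (mixing_matrix E P V V') C i"
proof -
  have xE: "x \<in> (\<Pi>\<^sub>E k\<in>{1..i}. space (E k))" using x by (simp add: space_PiM)
  define Q W W' where "Q = P i x x'" and "W = V i x x'" and "W' = V' i x x'"
  have Q: "prob_space Q" and W: "W \<in> Q \<rightarrow>\<^sub>M PiM {1..n} E" and W': "W' \<in> Q \<rightarrow>\<^sub>M PiM {1..n} E"
    and AE: "AE \<omega> in Q. (\<forall>k\<in>{1..i}. W \<omega> k = x k) \<and> (\<forall>k\<in>{1..<i}. W' \<omega> k = x k) \<and> W' \<omega> i = x'"
    and tail: "distr Q (PiM {i+1..n} E) (\<lambda>\<omega>. restrict (W \<omega>) {i+1..n}) = L i x"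
      "distr Q (PiM {i+1..n} E) (\<lambda>\<omega>. restrict (W' \<omega>) {i+1..n}) = L i (x(i := x'))"
    using coup i xE x' unfolding marton_coupling_def Q_def W_def W'_def by blast+
  interpret prob_space Q by fact
  let ?D = "\<lambda>j. {\<omega> \<in> space Q. W \<omega> j \<noteq> W' \<omega> j}"
  have D: "?D j \<in> sets Q" if "j \<in> {1..n}" for j
    using that by (intro neq[of j] measurable_compose[OF W] measurable_compose[OF W'] measurable_component_singleton)
  have xu: "x(i := x') \<in> space (PiM {1..i} E)"
    using xE x' i by (auto simp: space_PiM PiE_iff extensional_def)
  have int: "integrable Q (\<lambda>\<omega>. F (W \<omega>))" "integrable Q (\<lambda>\<omega>. F (W' \<omega>))"
    using measurable_compose[OF W F] measurable_compose[OF W' F] bd measurable_space[OF W] measurable_space[OF W']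
    by (auto intro!: integrable_const_bound[where B=b] AE_I2)
  have "(\<integral>y. F (merge {1..i} {i+1..n} (x, y)) \<partial>L i x) = (\<integral>\<omega>. F (W \<omega>) \<partial>Q)"
    using i AE by (intro integral_merge_coupling[OF _ x W F _ tail(1)]) (auto elim: eventually_mono)
  moreover have "(\<integral>y. F (merge {1..i} {i+1..n} (x(i := x'), y)) \<partial>L i (x(i := x'))) = (\<integral>\<omega>. F (W' \<omega>) \<partial>Q)"
    using i AE by (intro integral_merge_coupling[OF _ xu W' F _ tail(2)]) (auto elim: eventually_mono)
  ultimately have "(\<integral>y. F (merge {1..i} {i+1..n} (x, y)) \<partial>L i x)
      - (\<integral>y. F (merge {1..i} {i+1..n} (x(i := x'), y)) \<partial>L i (x(i := x'))) = (\<integral>\<omega>. F (W \<omega>) - F (W' \<omega>) \<partial>Q)"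
    using int by simp
  also have "\<dots> \<le> (\<integral>\<omega>. (\<Sum>j=1..n. C j * indicator (?D j) \<omega>) \<partial>Q)"
  proof (rule integral_mono)
    show "integrable Q (\<lambda>\<omega>. F (W \<omega>) - F (W' \<omega>))" using int by simp
    show "integrable Q (\<lambda>\<omega>. \<Sum>j=1..n. C j * indicator (?D j) \<omega>)"
      using D by (intro Bochner_Integration.integrable_sum integrable_mult_right integrable_real_indicator) (auto simp: emeasure_eq_measure)
    show "F (W \<omega>) - F (W' \<omega>) \<le> (\<Sum>j=1..n. C j * indicator (?D j) \<omega>)" if w: "\<omega> \<in> space Q" for \<omega>
      using lip[OF measurable_space[OF W w] measurable_space[OF W' w]] w by (simp add: indicator_def of_bool_def)
  qed
  also have "\<dots> = (\<Sum>j=1..n. C j * measure Q (?D j))"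
    using D by (subst Bochner_Integration.integral_sum) (auto simp: emeasure_eq_measure intro!: integrable_mult_right integrable_real_indicator sum.cong)
  also have "\<dots> \<le> (\<Sum>j=1..n. C j * mixing_matrix E P V V' i j)"
    using prob_neq_le_mixing_matrix[OF coup i _ xE x'] C
    by (intro sum_mono mult_left_mono) (auto simp: Q_def W_def W'_def)
  also have "\<dots> = mat_vec n (mixing_matrix E P V V') C i"
    by (simp add: mat_vec_def mult.commute)
  finally show ?thesis .
qed

section \<open>Norms\<close>

text \<open>A nonzero \<open>v\<close> is scaled to unit length and compared with the supremum; the
  zero vector is treated apart.\<close>

lemma L2_set_mat_vec_le:
  "L2_set (mat_vec n A v) {1..n} \<le> operator_norm n A * L2_set v {1..n}"
proof (cases "L2_set v {1..n} = 0")
  case True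
  then have "mat_vec n A v i = 0" for i
    by (simp add: mat_vec_def L2_set_eq_0_iff)
  then show ?thesis using True by (simp add: L2_set_def)
next
  case False
  define r where "r = L2_set v {1..n}"
  have r: "r > 0" using False L2_set_nonneg[of v "{1..n}"] by (simp add: r_def less_le)
  have bdd: "bdd_above ((\<lambda>v. L2_set (mat_vec n A v) {1..n}) ` {v. L2_set v {1..n} \<le> 1})"
  \<comment> \<open>Coordinates of a vector in the unit ball have modulus at most 1, so the sum of
    the moduli of all matrix entries bounds the norm of the image.\<close>
  proof (rule bdd_aboveI2[where M="\<Sum>i=1..n. \<Sum>j=1..n. \<bar>A i j\<bar>"])
    fix v assume "v \<in> {v. L2_set v {1..n} \<le> 1}"
    then have "L2_set (\<lambda>i. \<bar>v i\<bar>) {1..n} \<le> 1" by (simp add: L2_set_def)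
    then have v: "\<bar>v j\<bar> \<le> 1" if "j \<in> {1..n}" for j
      using member_le_L2_set[of "{1..n}" j "\<lambda>i. \<bar>v i\<bar>"] that by simp
    have "L2_set (mat_vec n A v) {1..n} \<le> (\<Sum>i=1..n. \<bar>mat_vec n A v i\<bar>)"
      by (rule L2_set_le_sum_abs)
    also have "\<dots> \<le> (\<Sum>i=1..n. \<Sum>j=1..n. \<bar>A i j\<bar>)"
    proof (rule sum_mono)
      fix i
      have "\<bar>mat_vec n A v i\<bar> \<le> (\<Sum>j=1..n. \<bar>A i j\<bar> * \<bar>v j\<bar>)"
        unfolding mat_vec_def by (rule order_trans[OF sum_abs]) (simp add: abs_mult)
      also have "\<dots> \<le> (\<Sum>j=1..n. \<bar>A i j\<bar> * 1)" using v by (intro sum_mono mult_left_mono) auto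
      finally show "\<bar>mat_vec n A v i\<bar> \<le> (\<Sum>j=1..n. \<bar>A i j\<bar>)" by simp
    qed
    finally show "L2_set (mat_vec n A v) {1..n} \<le> (\<Sum>i=1..n. \<Sum>j=1..n. \<bar>A i j\<bar>)" .
  qed
  have "L2_set (\<lambda>j. (1 / r) * v j) {1..n} = (1 / r) * r"
    unfolding r_def using r by (subst L2_set_right_distrib) (auto simp: r_def)
  then have "L2_set (mat_vec n A (\<lambda>j. (1 / r) * v j)) {1..n} \<le> operator_norm n A"
    unfolding operator_norm_def using r by (intro cSUP_upper[OF _ bdd]) auto
  moreover have "mat_vec n A (\<lambda>j. (1 / r) * v j) = (\<lambda>i. (1 / r) * mat_vec n A v i)"
    by (simp add: mat_vec_def sum_distrib_left sum_divide_distrib fun_eq_iff)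
  moreover have "L2_set (\<lambda>i. (1 / r) * mat_vec n A v i) {1..n} = (1 / r) * L2_set (mat_vec n A v) {1..n}"
    using r by (subst L2_set_right_distrib) auto
  ultimately show ?thesis using r unfolding r_def[symmetric] by (simp add: divide_le_eq)
qed

text \<open>Cauchy-Schwarz in each block costs the factor \<open>card (I i)\<close>, at most the
  size of the partition. As the blocks partition the indices, the remaining sums of squares add up
  to the square of the norm of \<open>c\<close>.\<close>

lemma L2_set_block_sum_le:
  assumes part: "index_partition N n I"
  shows "(L2_set (block_sum I c) {1..n})\<^sup>2 \<le> real (partition_size n I) * (L2_set c {1..N})\<^sup>2"
proof -
  have fin: "finite (I i)" if "i \<in> {1..n}" for i
  proof (rule finite_subset)
    show "I i \<subseteq> {1..N}" using part that unfolding index_partition_def by blast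
  qed simp
  have "(L2_set (block_sum I c) {1..n})\<^sup>2 = (\<Sum>i=1..n. (\<Sum>j\<in>I i. c j)\<^sup>2)"
    by (simp add: L2_set_def sum_nonneg block_sum_def)
  also have "\<dots> \<le> (\<Sum>i=1..n. real (partition_size n I) * (\<Sum>j\<in>I i. (c j)\<^sup>2))"
  proof (rule sum_mono)
    fix i assume i: "i \<in> {1..n}"
    have "(\<Sum>j\<in>I i. c j)\<^sup>2 \<le> (\<Sum>j\<in>I i. (c j)\<^sup>2) * real (card (I i))"
      using sum_squared_le_sum_of_squares[of c "I i"] by simp
    also have "\<dots> \<le> (\<Sum>j\<in>I i. (c j)\<^sup>2) * real (partition_size n I)"
      unfolding partition_size_def using i by (intro mult_left_mono sum_nonneg) auto
    finally show "(\<Sum>j\<in>I i. c j)\<^sup>2 \<le> real (partition_size n I) * (\<Sum>j\<in>I i. (c j)\<^sup>2)"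
      by (simp add: mult.commute)
  qed
  also have "\<dots> = real (partition_size n I) * (\<Sum>j\<in>(\<Union>i\<in>{1..n}. I i). (c j)\<^sup>2)"
    using fin part by (subst sum.UNION_disjoint) (auto simp: index_partition_def disjoint_family_on_def sum_distrib_left)
  also have "\<dots> = real (partition_size n I) * (L2_set c {1..N})\<^sup>2"
    using part by (simp add: index_partition_def L2_set_def sum_nonneg)
  finally show ?thesis .
qed

section \<open>Concentration for partitions\<close>

theorem theorem2p9:
  fixes M :: "'w measure"
    and N n :: nat
    and \<Lambda> :: "nat \<Rightarrow> 'a topology"
    and X :: "nat \<Rightarrow> 'w \<Rightarrow> 'a"
    and I :: "nat \<Rightarrow> nat set"
    and E :: "nat \<Rightarrow> (nat \<Rightarrow> 'a) measure"
    and L :: "nat \<Rightarrow> (nat \<Rightarrow> nat \<Rightarrow> 'a) \<Rightarrow> (nat \<Rightarrow> nat \<Rightarrow> 'a) measure"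
    and P :: "nat \<Rightarrow> (nat \<Rightarrow> nat \<Rightarrow> 'a) \<Rightarrow> (nat \<Rightarrow> 'a) \<Rightarrow> 'c measure"
    and V V' :: "nat \<Rightarrow> (nat \<Rightarrow> nat \<Rightarrow> 'a) \<Rightarrow> (nat \<Rightarrow> 'a) \<Rightarrow> 'c \<Rightarrow> nat \<Rightarrow> nat \<Rightarrow> 'a"
    and \<Gamma> :: "nat \<Rightarrow> nat \<Rightarrow> real"
    and c C :: "nat \<Rightarrow> real"
    and f :: "(nat \<Rightarrow> 'a) \<Rightarrow> real"
    and fX :: "'w \<Rightarrow> real"
    and Ef :: real
  assumes "prob_space M"
    and "\<And>j. j \<in> {1..N} \<Longrightarrow> polish_topology (\<Lambda> j)"
    and "\<And>j. j \<in> {1..N} \<Longrightarrow> X j \<in> M \<rightarrow>\<^sub>M borel_of (\<Lambda> j)"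
    and "index_partition N n I"
    and "E = (\<lambda>i. borel_prod (I i) \<Lambda>)"
    and "cond_distr_versions M n E (partitioned n I X) L"
    and "marton_coupling n E L P V V'"
    and "\<Gamma> = mixing_matrix E P V V'"
    and "\<And>j. j \<in> {1..N} \<Longrightarrow> 0 \<le> c j"
    and "C = block_sum I c"
    and "f \<in> borel_measurable (borel_prod {1..N} \<Lambda>)"
    and "\<And>x y. x \<in> (\<Pi>\<^sub>E j\<in>{1..N}. topspace (\<Lambda> j)) \<Longrightarrow> y \<in> (\<Pi>\<^sub>E j\<in>{1..N}. topspace (\<Lambda> j)) \<Longrightarrow>
           f x - f y \<le> (\<Sum>j\<in>{1..N}. c j * of_bool (x j \<noteq> y j))"
    and "fX = (\<lambda>\<omega>. f (rvec {1..N} X \<omega>))"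
    and "Ef = (\<integral>\<omega>. fX \<omega> \<partial>M)"
  shows "(\<forall>l::real.
           ln (\<integral>\<omega>. exp (l * (fX \<omega> - Ef)) \<partial>M)
             \<le> l\<^sup>2 * (L2_set (mat_vec n \<Gamma> C) {1..n})\<^sup>2 / 8
         \<and> l\<^sup>2 * (L2_set (mat_vec n \<Gamma> C) {1..n})\<^sup>2 / 8
             \<le> l\<^sup>2 * (operator_norm n \<Gamma>)\<^sup>2 * (L2_set c {1..N})\<^sup>2 * real (partition_size n I) / 8)
       \<and> (\<forall>t\<ge>0. measure M {\<omega> \<in> space M. t \<le> \<bar>fX \<omega> - Ef\<bar>}
           \<le> 2 * exp (- 2 * t\<^sup>2 / (L2_set (mat_vec n \<Gamma> C) {1..n})\<^sup>2))"
proof -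
  note E_def = assms(5) and coup = assms(7) and \<Gamma>_def = assms(8) and C_def = assms(10)
    and f = assms(11) and fX_def = assms(13) and Ef_def = assms(14)
  interpret prob_space M by (rule assms(1))
  let ?T = "\<lambda>J. \<Pi>\<^sub>E j\<in>J. topspace (\<Lambda> j)"

  \<comment> \<open>The function of the block vector and its Lipschitz constants\<close>
  have disj: "disjoint_family_on I {1..n}" and cover: "(\<Union>i\<in>{1..n}. I i) = {1..N}"
    using assms(4) by (auto simp: index_partition_def)
  have I_sub: "I i \<subseteq> {1..N}" if "i \<in> {1..n}" for i
    using cover that by blast
  have I_fin: "finite (I i)" if "i \<in> {1..n}" for i
    using I_sub[OF that] by (rule finite_subset) simp
  have "\<forall>j\<in>{1..N}. \<exists>i. i \<in> {1..n} \<and> j \<in> I i"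
    using cover by blast
  then obtain blk where blk: "blk j \<in> {1..n}" "j \<in> I (blk j)" if "j \<in> {1..N}" for j
    by metis
  have blk_eq: "blk j = i" if "i \<in> {1..n}" "j \<in> I i" for i j
    using disj that blk[of j] I_sub[OF that(1)] unfolding disjoint_family_on_def by blast
  \<comment> \<open>\<open>blk j\<close> is the unique block that contains \<open>j\<close>.
    \<open>glue\<close> reassembles a point of the original product from its blocks, so
    \<open>F\<close> is \<open>f\<close> read as a function of the blocks.\<close>
  define glue :: "(nat \<Rightarrow> nat \<Rightarrow> 'a) \<Rightarrow> nat \<Rightarrow> 'a" where "glue z = (\<lambda>j\<in>{1..N}. z (blk j) j)" for z
  define F where "F z = f (glue z)" for z
  define Y where "Y = partitioned n I X"
  have glue: "glue \<in> PiM {1..n} E \<rightarrow>\<^sub>M borel_prod {1..N} \<Lambda>"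
    unfolding glue_def
  proof (rule measurable_restrict)
    fix j assume j: "j \<in> {1..N}"
    have "(\<lambda>z. z (blk j)) \<in> PiM {1..n} E \<rightarrow>\<^sub>M borel_prod (I (blk j)) \<Lambda>"
      using measurable_component_singleton[OF blk(1)[OF j], of E] by (simp add: E_def)
    from measurable_compose[OF this measurable_component_singleton[OF blk(2)[OF j]]]
    show "(\<lambda>z. z (blk j) j) \<in> PiM {1..n} E \<rightarrow>\<^sub>M borel_of (\<Lambda> j)" .
  qed
  have glue_T: "glue z \<in> ?T {1..N}" if "z \<in> space (PiM {1..n} E)" for z
    using measurable_space[OF glue that] by (simp add: space_PiM)
  have F: "F \<in> borel_measurable (PiM {1..n} E)"
    unfolding F_def by (rule measurable_compose[OF glue f])
  have Y: "Y \<in> M \<rightarrow>\<^sub>M PiM {1..n} E"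
    unfolding Y_def partitioned_def[abs_def] rvec_def[abs_def] E_def
    using I_sub assms(3) by (intro measurable_restrict) blast
  have FY: "F (Y \<omega>) = fX \<omega>" for \<omega>
  proof -
    have "glue (Y \<omega>) = rvec {1..N} X \<omega>"
      using blk by (auto simp: glue_def Y_def partitioned_def rvec_def fun_eq_iff)
    then show ?thesis by (simp add: F_def fX_def)
  qed
  have C_nonneg: "0 \<le> C i" if "i \<in> {1..n}" for i
    unfolding C_def block_sum_def using I_sub[OF that] assms(9) by (intro sum_nonneg) blast
  \<comment> \<open>If two reassembled points differ at \<open>j\<close>, the blocks that contain
    \<open>j\<close> differ. Charging a differing block for all of its indices gives the weight
    \<open>C i\<close>.\<close>
  have lip: "F z - F w \<le> (\<Sum>i=1..n. C i * of_bool (z i \<noteq> w i))"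
    if z: "z \<in> space (PiM {1..n} E)" and w: "w \<in> space (PiM {1..n} E)" for z w
  proof -
    have "F z - F w \<le> (\<Sum>j\<in>{1..N}. c j * of_bool (glue z j \<noteq> glue w j))"
      unfolding F_def by (rule assms(12)[OF glue_T[OF z] glue_T[OF w]])
    also have "\<dots> = (\<Sum>i=1..n. \<Sum>j\<in>I i. c j * of_bool (glue z j \<noteq> glue w j))"
      unfolding cover[symmetric] using I_fin disj
      by (intro sum.UNION_disjoint) (auto simp: disjoint_family_on_def)
    also have "\<dots> \<le> (\<Sum>i=1..n. \<Sum>j\<in>I i. c j * of_bool (z i \<noteq> w i))"
    proof (intro sum_mono mult_left_mono)
      fix i j assume ij: "i \<in> {1..n}" "j \<in> I i"
      then have j: "j \<in> {1..N}" using I_sub by blast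
      then show "0 \<le> c j" by (rule assms(9))
      show "of_bool (glue z j \<noteq> glue w j) \<le> (of_bool (z i \<noteq> w i) :: real)"
        using j blk_eq[OF ij] by (auto simp: glue_def)
    qed
    also have "\<dots> = (\<Sum>i=1..n. C i * of_bool (z i \<noteq> w i))"
      by (simp add: C_def block_sum_def sum_distrib_right)
    finally show ?thesis .
  qed
  obtain \<omega>0 where \<omega>0: "\<omega>0 \<in> space M" using not_empty by blast
  \<comment> \<open>The Lipschitz condition keeps \<open>F\<close> within the total weight of its
    value at one reference point, so \<open>F\<close> is bounded and every integral below
    exists.\<close>
  define b where "b = \<bar>F (Y \<omega>0)\<bar> + (\<Sum>i=1..n. C i)"
  have F_bd: "\<bar>F z\<bar> \<le> b" if z: "z \<in> space (PiM {1..n} E)" for z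
  proof -
    have y: "Y \<omega>0 \<in> space (PiM {1..n} E)" by (rule measurable_space[OF Y \<omega>0])
    have le: "(\<Sum>i=1..n. C i * of_bool (z i \<noteq> w i)) \<le> (\<Sum>i=1..n. C i)" for z w :: "nat \<Rightarrow> nat \<Rightarrow> 'a"
      using C_nonneg by (intro sum_mono) (auto simp: of_bool_def)
    show ?thesis
      using lip[OF z y] lip[OF y z] le[of z "Y \<omega>0"] le[of "Y \<omega>0" z] by (simp add: b_def)
  qed

  \<comment> \<open>Kernels and disagreement events for the blocks\<close>
  \<comment> \<open>The given versions \<open>L i\<close> start at \<open>i = 1\<close>. At
    \<open>i = 0\<close> the unconditional law of the block vector is put in, so that every prefix
    length has a kernel.\<close>
  define K where "K i = (if i = 0 then (\<lambda>_. distr M (PiM {0+1..n} E) (\<lambda>\<omega>. restrict (Y \<omega>) {0+1..n})) else L i)" for i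
  have Yr: "(\<lambda>\<omega>. restrict (Y \<omega>) J) \<in> M \<rightarrow>\<^sub>M PiM J E" if "J \<subseteq> {1..n}" for J
    by (rule measurable_compose[OF Y measurable_restrict_subset[OF that]])
  have D: "disintegrates M (PiM {1..i} E) (PiM {i+1..n} E)
        (\<lambda>\<omega>. restrict (Y \<omega>) {1..i}) (\<lambda>\<omega>. restrict (Y \<omega>) {i+1..n}) (K i)" if i: "i \<le> n" for i
  proof (cases "i = 0")
    case True
    have "(\<lambda>\<omega>. restrict (Y \<omega>) {1..0}) = (\<lambda>_ _. undefined)" by (auto simp: fun_eq_iff)
    then show ?thesis unfolding True K_def
      using disintegrates_const[OF assms(1) Yr[of "{0+1..n}"], of "\<lambda>_. undefined" "PiM {1..0} E"]
      by (simp add: space_PiM)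
  next
    case False
    with i have "is_regular_cond_distr M (PiM {1..i} E) (PiM {i+1..n} E)
        (\<lambda>\<omega>. restrict (Y \<omega>) {1..i}) (\<lambda>\<omega>. restrict (Y \<omega>) {i+1..n}) (L i)"
      using assms(6) by (auto simp: cond_distr_versions_def Y_def)
    then show ?thesis
      using False i by (auto simp: K_def intro!: regular_cond_distr_disintegrates assms(1) Yr)
  qed
  \<comment> \<open>A block is itself a finite vector, so disagreement of two blocks reduces to
    disagreement of coordinates in Polish spaces.\<close>
  have neq: "{\<omega> \<in> space Q. g \<omega> \<noteq> h \<omega>} \<in> sets Q"
    if i: "i \<in> {1..n}" and "g \<in> Q \<rightarrow>\<^sub>M E i" "h \<in> Q \<rightarrow>\<^sub>M E i" for i g h and Q :: "'c measure"
  proof (rule neq_measurable_PiM[OF I_fin[OF i]])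
    show "g \<in> Q \<rightarrow>\<^sub>M borel_prod (I i) \<Lambda>" "h \<in> Q \<rightarrow>\<^sub>M borel_prod (I i) \<Lambda>"
      using that by (auto simp: E_def)
    fix j and g' h' :: "'c \<Rightarrow> 'a"
    assume "j \<in> I i" "g' \<in> Q \<rightarrow>\<^sub>M borel_of (\<Lambda> j)" "h' \<in> Q \<rightarrow>\<^sub>M borel_of (\<Lambda> j)"
    then show "{\<omega> \<in> space Q. g' \<omega> \<noteq> h' \<omega>} \<in> sets Q"
      using I_sub[OF i] by (intro neq_measurable_borel_of[OF assms(2)]) blast+
  qed

  \<comment> \<open>The exponential moment and the final bounds\<close>
  let ?s = "(L2_set (mat_vec n \<Gamma> C) {1..n})\<^sup>2"
  have s_eq: "?s = (\<Sum>i=1..n. (mat_vec n \<Gamma> C i)\<^sup>2)"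
    by (simp add: L2_set_def sum_nonneg)
  have mgf: "(\<integral>\<omega>. exp (l * (fX \<omega> - Ef)) \<partial>M) \<le> exp (l\<^sup>2 * ?s / 8)" for l
    unfolding s_eq Ef_def FY[symmetric]
  proof (rule exp_moment_kernel_martingale[OF assms(1) Y D F F_bd refl])
    fix i x x' assume i: "i \<in> {1..n}" and x: "x \<in> space (PiM {1..i} E)" and x': "x' \<in> space (E i)"
    show "(\<integral>y. F (merge {1..i} {i+1..n} (x, y)) \<partial>K i x)
      - (\<integral>y. F (merge {1..i} {i+1..n} (x(i := x'), y)) \<partial>K i (x(i := x'))) \<le> mat_vec n \<Gamma> C i"
      \<comment> \<open>Since \<open>i\<close> is at least 1, \<open>K i\<close> is the prescribed
        version \<open>L i\<close>, the one that the coupling refers to.\<close>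
      using marton_coupling_oscillation[OF coup F F_bd lip C_nonneg neq i x x'] i
      by (simp add: K_def \<Gamma>_def)
  qed
  have fX: "fX \<in> borel_measurable M"
    using measurable_compose[OF Y F] by (simp add: FY)
  have fX_bd: "\<bar>fX \<omega>\<bar> \<le> b" if "\<omega> \<in> space M" for \<omega>
    using F_bd[OF measurable_space[OF Y that]] by (simp add: FY)
  have int: "integrable M (\<lambda>\<omega>. exp (l * (fX \<omega> - Ef)))" for l
  proof (rule integrable_const_bound[where B="exp (\<bar>l\<bar> * (b + \<bar>Ef\<bar>))"])
    show "AE \<omega> in M. norm (exp (l * (fX \<omega> - Ef))) \<le> exp (\<bar>l\<bar> * (b + \<bar>Ef\<bar>))"
    proof (rule AE_I2)
      fix \<omega> assume "\<omega> \<in> space M"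
      then have "\<bar>fX \<omega> - Ef\<bar> \<le> b + \<bar>Ef\<bar>" using fX_bd by fastforce
      then have "\<bar>l * (fX \<omega> - Ef)\<bar> \<le> \<bar>l\<bar> * (b + \<bar>Ef\<bar>)" by (simp add: abs_mult mult_left_mono)
      then show "norm (exp (l * (fX \<omega> - Ef))) \<le> exp (\<bar>l\<bar> * (b + \<bar>Ef\<bar>))" by simp
    qed
  qed (use fX in measurable)
  show ?thesis
  proof (intro conjI allI impI)
    fix l :: real
    let ?J = "\<integral>\<omega>. exp (l * (fX \<omega> - Ef)) \<partial>M"
    have "0 \<le> ?J" by simp
    \<comment> \<open>By the convention \<open>ln 0 = 0\<close> the first case is immediate, so
      strict positivity of the integral need not be proved.\<close>
    then consider "?J = 0" | "0 < ?J" by linarith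
    then show "ln ?J \<le> l\<^sup>2 * ?s / 8"
    proof cases
      case 1
      then show ?thesis by simp
    next
      case 2
      then have "ln ?J \<le> ln (exp (l\<^sup>2 * ?s / 8))" using mgf[of l] by (subst ln_le_cancel_iff) auto
      then show ?thesis by simp
    qed
    have "?s \<le> (operator_norm n \<Gamma> * L2_set C {1..n})\<^sup>2"
      by (intro power_mono L2_set_mat_vec_le) simp
    also have "\<dots> = (operator_norm n \<Gamma>)\<^sup>2 * (L2_set C {1..n})\<^sup>2"
      by (rule power_mult_distrib)
    also have "\<dots> \<le> (operator_norm n \<Gamma>)\<^sup>2 * (real (partition_size n I) * (L2_set c {1..N})\<^sup>2)"
      unfolding C_def by (intro mult_left_mono L2_set_block_sum_le assms(4)) simp
    finally have "l\<^sup>2 * ?s \<le> l\<^sup>2 * ((operator_norm n \<Gamma>)\<^sup>2 * (real (partition_size n I) * (L2_set c {1..N})\<^sup>2))"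
      by (rule mult_left_mono) simp
    then show "l\<^sup>2 * ?s / 8
        \<le> l\<^sup>2 * (operator_norm n \<Gamma>)\<^sup>2 * (L2_set c {1..N})\<^sup>2 * real (partition_size n I) / 8"
      by (simp add: mult.commute mult.left_commute)
  next
    fix t :: real assume "0 \<le> t"
    then show "measure M {\<omega> \<in> space M. t \<le> \<bar>fX \<omega> - Ef\<bar>} \<le> 2 * exp (- 2 * t\<^sup>2 / ?s)"
      using int mgf fX by (intro subgaussian_two_sided_tail) auto
  qed
qed

end
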